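(* Let $N\ge2$, let $(X_i,d_{X_i})$ be Polish metric spaces and $\rho_i\in\mathcal{P}(X_i)$ probability measures for $i\in\{1,\dots,N\}$, let $c:X_1\times\dots\times X_N\to\mathbb{R}$ be a bounded Borel cost and $\varepsilon>0$. Let $(a_i^n)_{n\in\mathbb{N}}$, $i=1,\dots,N$, be the multi-marginal IPFP sequences. Then there exist $\lambda_i^n>0$ with $\prod_{i=1}^N\lambda_i^n=1$ for every $n$, and functions $(a_1,\dots,a_N)$ solving the multi-marginal Schrödinger system, such that $$a_i^n/\lambda_i^n\to a_i\ \text{ in } L^p(\rho_i)\quad\text{for all } i\in\{1,\dots,N\},\ 1\le p<+\infty.$$ In particular, the densities $\prod_{i=1}^N a_i^n(x_i)\,k^N(x_1,\dots,x_N)$ (with respect to $\rho^N$) of the measures $\gamma^n_N=\left(\prod_{i=1}^N a_i^n(x_i)\right)\mathcal{K}$ converge in $L^p(\rho_1\otimes\dots\otimes\rho_N)$, for every $1\le p<+\infty$, to the density of the optimal coupling $\gamma^{\varepsilon}_{N,opt}$ solving the multi-marginal Schrödinger problem $\inf_{\gamma\in\Pi(\rho_1,\dots,\rho_N)}\varepsilon\,\mathrm{KL}^N(\gamma|\mathcal{K})$.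
   Context: $\rho^N=\rho_1\otimes\dots\otimes\rho_N$, $k^N=e^{-c/\varepsilon}$, $\mathcal{K}=k^N\rho^N$. $\Pi(\rho_1,\dots,\rho_N)$ is the set of probability measures on $X_1\times\dots\times X_N$ whose $i$-th marginal is $\rho_i$ for every $i$. $\mathrm{KL}^N(\gamma|\mathcal{K})=\int\gamma\log(\gamma/k^N)\,d\rho^N$ if $\gamma\ll\rho^N$ (with $\gamma$ also denoting its density with respect to $\rho^N$), and $+\infty$ otherwise. The multi-marginal Schrödinger problem has a unique minimizer $\gamma^\varepsilon_{N,opt}$. Multi-marginal IPFP sequences: $a_j^0\equiv1$ for all $j\in\{1,\dots,N\}$, and for $n\ge1$ and $j=1,\dots,N$ (in this order) $$a_j^n(x_j)=\frac{1}{\int_{\prod_{i\ne j}X_i}\ \prod_{i<j}a_i^n(x_i)\prod_{i>j}a_i^{n-1}(x_i)\,k^N(x_1,\dots,x_N)\,d(\otimes_{i\neq j}\rho_i)}.$$ Multi-marginal Schrödinger system: nonnegative measurable $a_i$ on $X_i$ solve it if for every $i$ and $\rho_i$-a.e. $x_i$ $$a_i(x_i)\int_{\prod_{j\neq i}X_j}\prod_{j\ne i}a_j(x_j)\,k^N(x_1,\dots,x_N)\,d(\otimes_{j\neq i}\rho_j)=1.$$ *)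

theory Defs
  imports "HOL-Probability.Probability"
begin

text \<open>
  The spaces \<open>X\<^sub>1, \<dots>, X\<^sub>N\<close> are metric spaces (type \<open>'a metric\<close>) carried by subsets of one common
  type \<open>'a\<close>; the carriers and metrics may differ with the index, and any finite family of metric
  spaces can be relabelled isometrically into such a form.  Points of \<open>X\<^sub>1 \<times> \<dots> \<times> X\<^sub>N\<close> are
  extensional functions on \<open>{1..N}\<close>.
\<close>

definition polish_metric :: "'a metric \<Rightarrow> bool" where
  "polish_metric X \<longleftrightarrow> mcomplete_of X \<and> separable_space (mtopology_of X)"

definition borel_of :: "'a topology \<Rightarrow> 'a measure" where
  "borel_of T = sigma (topspace T) {U. openin T U}"

definition gibbs :: "((nat \<Rightarrow> 'a) \<Rightarrow> real) \<Rightarrow> real \<Rightarrow> (nat \<Rightarrow> 'a) \<Rightarrow> real" where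
  "gibbs c \<epsilon> x = exp (- c x / \<epsilon>)"

text \<open>\<open>ipfp N \<rho> c \<epsilon> n j\<close> is the function \<open>a\<^sub>j\<^sup>n\<close>; only indices \<open>j \<in> {1..N}\<close> are meaningful.\<close>

fun ipfp :: "nat \<Rightarrow> (nat \<Rightarrow> 'a measure) \<Rightarrow> ((nat \<Rightarrow> 'a) \<Rightarrow> real) \<Rightarrow> real \<Rightarrow> nat \<Rightarrow> nat \<Rightarrow> 'a \<Rightarrow> real" where
  "ipfp N \<rho> c \<epsilon> 0 j = (\<lambda>x. 1)"
| "ipfp N \<rho> c \<epsilon> (Suc n) j =
     (\<lambda>x. 1 / (\<integral>y. (\<Prod>i\<in>{1..<j}. ipfp N \<rho> c \<epsilon> (Suc n) i (y i)) *
                   (\<Prod>i\<in>{j<..N}. ipfp N \<rho> c \<epsilon> n i (y i)) *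
                   gibbs c \<epsilon> (y(j := x))
               \<partial>(\<Pi>\<^sub>M i\<in>{1..N} - {j}. \<rho> i)))"

text \<open>The integrand below is nonnegative; as an infinite Bochner integral is \<open>0\<close>, the equation
  also forces the integral to be finite.\<close>

definition schrodinger_system ::
  "nat \<Rightarrow> (nat \<Rightarrow> 'a measure) \<Rightarrow> ((nat \<Rightarrow> 'a) \<Rightarrow> real) \<Rightarrow> real \<Rightarrow> (nat \<Rightarrow> 'a \<Rightarrow> real) \<Rightarrow> bool" where
  "schrodinger_system N \<rho> c \<epsilon> a \<longleftrightarrow>
     (\<forall>i\<in>{1..N}. a i \<in> borel_measurable (\<rho> i) \<and> (\<forall>x\<in>space (\<rho> i). 0 \<le> a i x)) \<and>
     (\<forall>i\<in>{1..N}. AE x in \<rho> i.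
        a i x * (\<integral>y. (\<Prod>j\<in>{1..N} - {i}. a j (y j)) * gibbs c \<epsilon> (y(i := x))
                   \<partial>(\<Pi>\<^sub>M j\<in>{1..N} - {i}. \<rho> j)) = 1)"

definition in_Lp :: "real \<Rightarrow> 'b measure \<Rightarrow> ('b \<Rightarrow> real) \<Rightarrow> bool" where
  "in_Lp p M f \<longleftrightarrow> f \<in> borel_measurable M \<and> integrable M (\<lambda>x. \<bar>f x\<bar> powr p)"

definition Lp_norm :: "real \<Rightarrow> 'b measure \<Rightarrow> ('b \<Rightarrow> real) \<Rightarrow> real" where
  "Lp_norm p M f = (\<integral>x. \<bar>f x\<bar> powr p \<partial>M) powr (1 / p)"

definition Lp_tendsto :: "real \<Rightarrow> 'b measure \<Rightarrow> (nat \<Rightarrow> 'b \<Rightarrow> real) \<Rightarrow> ('b \<Rightarrow> real) \<Rightarrow> bool" where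
  "Lp_tendsto p M f g \<longleftrightarrow> (\<forall>n. in_Lp p M (f n)) \<and> in_Lp p M g \<and>
     (\<lambda>n. Lp_norm p M (\<lambda>x. f n x - g x)) \<longlonglongrightarrow> 0"

text \<open>The \<open>\<sigma>\<close>-algebra of the couplings is that of the product measure; for Polish spaces this is the
  Borel \<open>\<sigma>\<close>-algebra of the product topology, see \<open>sets_borel_of_product\<close> below.\<close>

definition couplings :: "nat \<Rightarrow> (nat \<Rightarrow> 'a measure) \<Rightarrow> (nat \<Rightarrow> 'a) measure set" where
  "couplings N \<rho> = {\<gamma>. prob_space \<gamma> \<and> sets \<gamma> = sets (\<Pi>\<^sub>M i\<in>{1..N}. \<rho> i) \<and>
     (\<forall>i\<in>{1..N}. distr \<gamma> (\<rho> i) (\<lambda>x. x i) = \<rho> i)}"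

definition real_density :: "'b measure \<Rightarrow> 'b measure \<Rightarrow> 'b \<Rightarrow> real" where
  "real_density R \<gamma> x = enn2real (RN_deriv R \<gamma> x)"

text \<open>\<open>ereal_integral\<close> is the integral as an extended real, positive minus negative part.  It
  is used for the relative entropy because the integrand \<open>g ln (g / k)\<close> has an integrable negative
  part but possibly an infinite integral, which the Bochner integral would turn into \<open>0\<close>.
  \<open>KL R k \<gamma>\<close> is the entropy of \<open>\<gamma>\<close> relative to the measure with density \<open>k\<close> with respect to \<open>R\<close>.\<close>

definition ereal_integral :: "'b measure \<Rightarrow> ('b \<Rightarrow> real) \<Rightarrow> ereal" where
  "ereal_integral M f =
     enn2ereal (\<integral>\<^sup>+x. ennreal (f x) \<partial>M) - enn2ereal (\<integral>\<^sup>+x. ennreal (- f x) \<partial>M)"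

definition KL :: "'b measure \<Rightarrow> ('b \<Rightarrow> real) \<Rightarrow> 'b measure \<Rightarrow> ereal" where
  "KL R k \<gamma> = (if absolutely_continuous R \<gamma>
     then ereal_integral R (\<lambda>x. real_density R \<gamma> x * ln (real_density R \<gamma> x / k x))
     else \<infinity>)"

definition solves_schrodinger_problem ::
  "nat \<Rightarrow> (nat \<Rightarrow> 'a measure) \<Rightarrow> ((nat \<Rightarrow> 'a) \<Rightarrow> real) \<Rightarrow> real \<Rightarrow> (nat \<Rightarrow> 'a) measure \<Rightarrow> bool" where
  "solves_schrodinger_problem N \<rho> c \<epsilon> \<gamma> \<longleftrightarrow>
     is_arg_min (\<lambda>\<gamma>. ereal \<epsilon> * KL (\<Pi>\<^sub>M i\<in>{1..N}. \<rho> i) (gibbs c \<epsilon>) \<gamma>)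
       (\<lambda>\<gamma>. \<gamma> \<in> couplings N \<rho>) \<gamma>"

lemma space_borel_of [simp]: "space (borel_of T) = topspace T"
  and sets_borel_of: "sets (borel_of T) = sigma_sets (topspace T) {U. openin T U}"
  unfolding borel_of_def
  by (rule space_measure_of, blast dest: openin_subset)
     (rule sets_measure_of, blast dest: openin_subset)

lemma borel_of_open: "openin T U \<Longrightarrow> U \<in> sets (borel_of T)"
  by (simp add: sets_borel_of sigma_sets.Basic)

lemma separable_metric_countable_base:
  assumes "separable_space (mtopology_of X)"
  shows "\<exists>B. countable B \<and> (\<forall>V\<in>B. openin (mtopology_of X) V) \<and>
    (\<forall>U x. openin (mtopology_of X) U \<and> x \<in> U \<longrightarrow> (\<exists>V\<in>B. x \<in> V \<and> V \<subseteq> U))"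
proof -
  interpret Metric_space "mspace X" "mdist X" by simp
  have T: "mtopology_of X = mtopology" by (simp add: mtopology_of_def)
  obtain C where C: "countable C" "C \<subseteq> mspace X" "mtopology closure_of C = mspace X"
    using assms by (auto simp: separable_space_def T)
  define B where "B = (\<lambda>(x, n). mball x (1 / real (Suc n))) ` (C \<times> (UNIV :: nat set))"
  have "\<exists>V\<in>B. x \<in> V \<and> V \<subseteq> U" if U: "openin mtopology U" "x \<in> U" for U x
  proof -
    obtain r where r: "r > 0" "mball x r \<subseteq> U" and x: "x \<in> mspace X"
      using U unfolding openin_mtopology by blast
    obtain n where n: "1 / real (Suc n) < r / 2"
      using r(1) by (metis half_gt_zero nat_approx_posE)
    obtain y where y: "y \<in> C" "y \<in> mball x (1 / real (Suc n))"
    proof -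
      have "x \<in> mtopology closure_of C" using C x by simp
      moreover have "openin mtopology (mball x (1 / real (Suc n)))" by simp
      moreover have "x \<in> mball x (1 / real (Suc n))" using x by simp
      ultimately show ?thesis using that unfolding in_closure_of by blast
    qed
    have "x \<in> mball y (1 / real (Suc n))" using y by (simp add: commute)
    moreover have "mball y (1 / real (Suc n)) \<subseteq> mball x r"
    proof
      fix z assume z: "z \<in> mball y (1 / real (Suc n))"
      with y have "mdist X x z \<le> mdist X x y + mdist X y z" by (intro triangle) auto
      also have "\<dots> < r" using y z n unfolding in_mball by linarith
      finally show "z \<in> mball x r" using z x by simp
    qed
    ultimately show ?thesis using y(1) r(2) by (force simp: B_def)
  qed
  moreover have "countable B" "\<forall>V\<in>B. openin mtopology V" using C(1) by (auto simp: B_def)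
  ultimately show ?thesis unfolding T by blast
qed

lemma sets_borel_of_product:
  assumes I: "finite I" and sep: "\<And>i. i \<in> I \<Longrightarrow> separable_space (mtopology_of (X i))"
  shows "sets (borel_of (product_topology (\<lambda>i. mtopology_of (X i)) I)) =
         sets (\<Pi>\<^sub>M i\<in>I. borel_of (mtopology_of (X i)))" (is "sets (borel_of ?T) = sets ?P")
proof
  from separable_metric_countable_base[OF sep] have "\<forall>i\<in>I. \<exists>B. countable B \<and> (\<forall>V\<in>B. openin (mtopology_of (X i)) V) \<and>
    (\<forall>U x. openin (mtopology_of (X i)) U \<and> x \<in> U \<longrightarrow> (\<exists>V\<in>B. x \<in> V \<and> V \<subseteq> U))"
    by (rule ballI)
  from bchoice[OF this] obtain B where B0: "\<forall>i\<in>I. countable (B i) \<and>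
    (\<forall>V\<in>B i. openin (mtopology_of (X i)) V) \<and>
    (\<forall>U x. openin (mtopology_of (X i)) U \<and> x \<in> U \<longrightarrow> (\<exists>V\<in>B i. x \<in> V \<and> V \<subseteq> U))" ..
  then have B: "\<And>i. i \<in> I \<Longrightarrow> countable (B i)"
    "\<And>i V. i \<in> I \<Longrightarrow> V \<in> B i \<Longrightarrow> openin (mtopology_of (X i)) V"
    "\<And>i U x. i \<in> I \<Longrightarrow> openin (mtopology_of (X i)) U \<Longrightarrow> x \<in> U \<Longrightarrow> \<exists>V\<in>B i. x \<in> V \<and> V \<subseteq> U"
    by simp_all
  have "U \<in> sets ?P" if U: "openin ?T U" for U
  proof -
    define K where "K = {S \<in> Pi\<^sub>E I ` (Pi\<^sub>E I B). S \<subseteq> U}"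
    have "countable (Pi\<^sub>E I B)" using I B(1) by (rule countable_PiE)
    hence "countable K" unfolding K_def by simp
    moreover have "S \<in> sets ?P" if "S \<in> K" for S
      using that B(2) I unfolding K_def by (auto intro!: sets_PiM_I_finite borel_of_open)
    ultimately have "\<Union>K \<in> sets ?P" by blast
    moreover have "U \<subseteq> \<Union>K"
    proof
      fix x assume "x \<in> U"
      moreover have "\<forall>x\<in>U. \<exists>V. finite {i \<in> I. V i \<noteq> topspace (mtopology_of (X i))} \<and>
          (\<forall>i\<in>I. openin (mtopology_of (X i)) (V i)) \<and> x \<in> Pi\<^sub>E I V \<and> Pi\<^sub>E I V \<subseteq> U"
        using U unfolding openin_product_topology_alt .
      ultimately obtain V where V: "\<And>i. i \<in> I \<Longrightarrow> openin (mtopology_of (X i)) (V i)"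
          "x \<in> Pi\<^sub>E I V" "Pi\<^sub>E I V \<subseteq> U"
        by (metis (no_types, lifting))
      have "\<forall>i\<in>I. \<exists>W. W \<in> B i \<and> x i \<in> W \<and> W \<subseteq> V i" using B(3) V by (meson PiE_mem)
      from bchoice[OF this] obtain W
        where W: "\<And>i. i \<in> I \<Longrightarrow> W i \<in> B i \<and> x i \<in> W i \<and> W i \<subseteq> V i" by auto
      have e: "Pi\<^sub>E I (restrict W I) = Pi\<^sub>E I W" by (rule PiE_cong) simp
      have "Pi\<^sub>E I W \<subseteq> Pi\<^sub>E I V" using W by (intro PiE_mono) blast
      hence "Pi\<^sub>E I W \<in> K"
        unfolding K_def using V(3) W e by (auto intro!: image_eqI[of _ _ "restrict W I"])
      moreover have "x \<in> Pi\<^sub>E I W" using V(2) W by (auto simp: PiE_iff)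
      ultimately show "x \<in> \<Union>K" by blast
    qed
    ultimately show ?thesis unfolding K_def by (metis (no_types, lifting) Sup_least mem_Collect_eq subset_antisym)
  qed
  moreover have "topspace ?T = space ?P" by (simp add: space_PiM)
  ultimately show "sets (borel_of ?T) \<subseteq> sets ?P"
    unfolding sets_borel_of by (metis (mono_tags, lifting) mem_Collect_eq sets.sigma_sets_subset subsetI)
next
  have "(\<lambda>x. x) \<in> measurable (borel_of ?T) ?P"
  proof (rule measurable_PiM_single')
    fix i assume i: "i \<in> I"
    have "{U. openin (mtopology_of (X i)) U} \<subseteq> Pow (topspace (mtopology_of (X i)))"
      by (blast dest: openin_subset)
    moreover have "(\<lambda>x. x i) \<in> space (borel_of ?T) \<rightarrow> topspace (mtopology_of (X i))"
      using i by auto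
    moreover have "(\<lambda>x. x i) -` U \<inter> space (borel_of ?T) \<in> sets (borel_of ?T)"
      if "openin (mtopology_of (X i)) U" for U
    proof -
      have "continuous_map ?T (mtopology_of (X i)) (\<lambda>x. x i)"
        using i by (rule continuous_map_product_projection)
      hence "openin ?T {x \<in> topspace ?T. x i \<in> U}"
        using that by (rule openin_continuous_map_preimage)
      moreover have "{x \<in> topspace ?T. x i \<in> U} = (\<lambda>x. x i) -` U \<inter> space (borel_of ?T)" by auto
      ultimately show ?thesis using borel_of_open by metis
    qed
    ultimately show "(\<lambda>x. x i) \<in> measurable (borel_of ?T) (borel_of (mtopology_of (X i)))"
      unfolding borel_of_def[of "mtopology_of (X i)"] by (intro measurable_measure_of) auto
  qed auto
  note id = this
  show "sets ?P \<subseteq> sets (borel_of ?T)"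
  proof
    fix A assume A: "A \<in> sets ?P"
    have "A \<subseteq> space (borel_of ?T)"
      using sets.sets_into_space[OF A] by (simp add: space_PiM)
    then show "A \<in> sets (borel_of ?T)"
      using measurable_sets[OF id A] by (simp add: Int_absorb2)
  qed
qed

end

theory Submission
  imports Defs
begin

text \<open>
  The iteration is block coordinate ascent for the dual functional.  By a Harnack inequality each
  Sinkhorn potential varies by a factor of at most \<open>K\<^sup>2\<close>, so all densities met along the way lie
  between \<open>1 / B\<close> and \<open>B\<close>.  On this bounded range the functional is strongly concave in the sum of
  the logarithmic potentials, and a sweep gains at least a multiple of the squared \<open>L\<^sup>2\<close> norm of its
  increments.  Since each partial gradient vanishes right after the update of its coordinate,
  strong concavity also bounds the remaining gain by the same squared norm.  Hence the increments
  decay geometrically, in \<open>L\<^sup>2\<close> and then, through one more application of the update formula,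
  uniformly.  The potentials therefore converge without normalisation, and \<open>\<lambda>\<^sub>i\<^sup>n = 1\<close> works.  The
  limit yields a coupling whose density has the product form that makes the entropy split into
  a constant and a relative entropy, which identifies it as the unique minimiser.
\<close>

subsection \<open>Exponential estimates and a geometric decay criterion\<close>

text \<open>Adding constants with sum zero to the logarithmic potentials changes neither the dual
  functional nor the density \<open>gibbs_density b\<close>. This gauge freedom is what the numbers
  \<open>l\<close> of the theorem are meant for, and it is why strong concavity is available only in
  the sum of the logarithms. It is harmless for two reasons. Comparing two stages of the iteration
  involves only the centred differences of the potentials and the sum of their means, which is the
  difference of the energies; both are determined by the sum. And a single update is strongly
  concave in its own coordinate, so the ascent controls every individual increment, constants
  included, and summability of the increments fixes the gauge. The dual functional is the sum of the
  integrals of the logarithmic potentials minus the mass of the density. The mass is 1 after every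
  update, so only the first term, \<open>energy\<close>, is tracked. Before the first update the
  density is the kernel, whose mass need not be 1; hence the restrictions to indices \<ge>
  1.\<close>

lemma exp_quadratic_lower:
  fixes u D :: real
  assumes "\<bar>u\<bar> \<le> D"
  shows "exp u - 1 - u \<ge> exp (- D) / 2 * u\<^sup>2"
proof -
  obtain t where t: "\<bar>t\<bar> \<le> \<bar>u\<bar>" "exp u = (\<Sum>m<2. u ^ m / fact m) + exp t / fact 2 * u ^ 2"
    using Maclaurin_exp_le[of u 2] by blast
  have "exp (- D) \<le> exp t" using t(1) assms by simp
  hence "exp (- D) / 2 * u\<^sup>2 \<le> exp t / 2 * u\<^sup>2" by (intro mult_right_mono) auto
  thus ?thesis using t(2) by (simp add: numeral_2_eq_2)
qed

text \<open>Mean value theorem: \<open>exp u - 1\<close> is \<open>u\<close> times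
  \<open>exp t\<close> for some \<open>t\<close> between \<open>-D\<close> and \<open>D\<close>. The
  first bound passes from potentials to densities, the second from marginals back to
  potentials.\<close>

lemma exp_minus_one_two_sided:
  fixes u D :: real
  assumes "\<bar>u\<bar> \<le> D"
  shows "\<bar>exp u - 1\<bar> \<le> exp D * \<bar>u\<bar>" "\<bar>u\<bar> \<le> exp D * \<bar>exp u - 1\<bar>"
proof -
  obtain t where t: "\<bar>t\<bar> \<le> \<bar>u\<bar>" "exp u = (\<Sum>m<1. u ^ m / fact m) + exp t / fact 1 * u ^ 1"
    using Maclaurin_exp_le[of u 1] by blast
  have e: "\<bar>exp u - 1\<bar> = exp t * \<bar>u\<bar>" using t(2) by (simp add: abs_mult)
  show "\<bar>exp u - 1\<bar> \<le> exp D * \<bar>u\<bar>" unfolding e using t(1) assms by (intro mult_right_mono) auto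
  have "1 * \<bar>u\<bar> \<le> (exp D * exp t) * \<bar>u\<bar>"
    using t(1) assms by (intro mult_right_mono) (auto simp: exp_add[symmetric])
  thus "\<bar>u\<bar> \<le> exp D * \<bar>exp u - 1\<bar>" unfolding e by simp
qed

text \<open>With \<open>S\<close> the supremum of the values, \<open>tail\<close> reads (S - L(n+1))
  \<le> C ((S - L n) - (S - L(n+1))), so the gap to \<open>S\<close> shrinks by the factor
  \<open>C / (1 + C)\<close> in each step, and an increment is at most the gap before it. Letting
  \<open>m\<close> in \<open>tail\<close> be arbitrary makes boundedness a consequence instead of an
  assumption.\<close>

lemma geometric_increments:
  fixes L :: "nat \<Rightarrow> real"
  assumes mono: "\<And>n. n \<ge> 1 \<Longrightarrow> L n \<le> L (Suc n)"
    and C: "C > 0"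
    and tail: "\<And>n m. n \<ge> 1 \<Longrightarrow> m \<ge> 1 \<Longrightarrow> L m - L (Suc n) \<le> C * (L (Suc n) - L n)"
  obtains A q where "A \<ge> 0" "0 < q" "q < 1" "\<And>n. n \<ge> 1 \<Longrightarrow> L (Suc n) - L n \<le> A * q ^ n"
proof -
  define S where "S = Sup (L ` {1..})"
  define q where "q = C / (1 + C)"
  have q: "0 < q" "q < 1" using C by (auto simp: q_def)
  have bdd: "bdd_above (L ` {1..})"
  proof (rule bdd_aboveI)
    fix y assume "y \<in> L ` {1..}"
    then obtain m where "m \<ge> 1" "y = L m" by auto
    with tail[of 1 m] show "y \<le> L (Suc 1) + C * (L (Suc 1) - L 1)" by simp
  qed
  have le: "L n \<le> S" if "n \<ge> 1" for n
    unfolding S_def using that bdd by (intro cSup_upper) auto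
  have step: "S - L (Suc n) \<le> q * (S - L n)" if "n \<ge> 1" for n
  proof -
    have "S \<le> L (Suc n) + C * (L (Suc n) - L n)"
      unfolding S_def by (rule cSup_least) (use tail[OF that] in \<open>auto simp: diff_le_eq add.commute\<close>)
    thus ?thesis using C unfolding q_def by (simp add: field_simps)
  qed
  have dec: "S - L n \<le> (S - L 1) * q ^ (n - 1)" if "n \<ge> 1" for n
    using that
  proof (induction n rule: dec_induct)
    case base thus ?case by simp
  next
    case (step m)
    have "S - L (Suc m) \<le> q * (S - L m)" using step.hyps by (intro \<open>\<And>n. n \<ge> 1 \<Longrightarrow> S - L (Suc n) \<le> q * (S - L n)\<close>)
    also have "\<dots> \<le> q * ((S - L 1) * q ^ (m - 1))" using step.IH q by (intro mult_left_mono) auto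
    also have "\<dots> = (S - L 1) * q ^ (Suc m - 1)"
      using step.hyps by (cases m) (auto simp: algebra_simps)
    finally show ?case .
  qed
  show ?thesis
  \<comment> \<open>The decay starts at index 1, so the gap carries the exponent
    \<open>n - 1\<close>; dividing by \<open>q\<close> restores \<open>n\<close>.\<close>
  proof (rule that[of "(S - L 1) / q" q])
    show "0 \<le> (S - L 1) / q" using le[of 1] q by simp
    fix n :: nat assume n: "n \<ge> 1"
    have "L (Suc n) - L n \<le> S - L n" using le[of "Suc n"] by simp
    also have "\<dots> \<le> (S - L 1) * q ^ (n - 1)" using dec[OF n] .
    also have "\<dots> = (S - L 1) / q * q ^ n" using n q by (cases n) auto
    finally show "L (Suc n) - L n \<le> (S - L 1) / q * q ^ n" .
  qed (use q in auto)
qed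

subsection \<open>Bounded measurable functions\<close>

text \<open>The bound holds at every point and not just almost everywhere, so that it survives
  fixing one coordinate at an arbitrary value: such a slice may be a null set of the
  product.\<close>

definition bounded_measurable :: "'b measure \<Rightarrow> ('b \<Rightarrow> real) \<Rightarrow> bool" where
  "bounded_measurable R f \<longleftrightarrow> f \<in> borel_measurable R \<and> (\<exists>B. \<forall>x\<in>space R. \<bar>f x\<bar> \<le> B)"

lemma bounded_measurableI:
  "f \<in> borel_measurable R \<Longrightarrow> (\<And>x. x \<in> space R \<Longrightarrow> \<bar>f x\<bar> \<le> B) \<Longrightarrow> bounded_measurable R f"
  by (auto simp: bounded_measurable_def)

lemma bounded_measurable_measurable: "bounded_measurable R f \<Longrightarrow> f \<in> borel_measurable R"
  by (auto simp: bounded_measurable_def)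

lemma bounded_measurable_const: "bounded_measurable R (\<lambda>x. a)"
  by (auto simp: bounded_measurable_def)

lemma bounded_measurable_add:
  assumes "bounded_measurable R f" "bounded_measurable R g"
  shows "bounded_measurable R (\<lambda>x. f x + g x)"
proof -
  obtain A B where "\<forall>x\<in>space R. \<bar>f x\<bar> \<le> A" "\<forall>x\<in>space R. \<bar>g x\<bar> \<le> B"
    using assms unfolding bounded_measurable_def by blast
  hence "\<forall>x\<in>space R. \<bar>f x + g x\<bar> \<le> A + B" by (meson abs_triangle_ineq add_mono order_trans)
  thus ?thesis using assms unfolding bounded_measurable_def by auto
qed

lemma bounded_measurable_mult:
  assumes "bounded_measurable R f" "bounded_measurable R g"
  shows "bounded_measurable R (\<lambda>x. f x * g x)"
proof -
  obtain A B where *: "\<forall>x\<in>space R. \<bar>f x\<bar> \<le> A" "\<forall>x\<in>space R. \<bar>g x\<bar> \<le> B"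
    using assms unfolding bounded_measurable_def by blast
  have "\<bar>f x * g x\<bar> \<le> \<bar>A\<bar> * \<bar>B\<bar>" if "x \<in> space R" for x
    unfolding abs_mult using * that by (intro mult_mono) force+
  thus ?thesis using assms unfolding bounded_measurable_def by auto
qed

lemma bounded_measurable_uminus: "bounded_measurable R f \<Longrightarrow> bounded_measurable R (\<lambda>x. - f x)"
  by (auto simp: bounded_measurable_def)

lemma bounded_measurable_abs: "bounded_measurable R f \<Longrightarrow> bounded_measurable R (\<lambda>x. \<bar>f x\<bar>)"
  by (auto simp: bounded_measurable_def)

lemma bounded_measurable_diff:
  assumes "bounded_measurable R f" "bounded_measurable R g"
  shows "bounded_measurable R (\<lambda>x. f x - g x)"
  using bounded_measurable_add[OF assms(1) bounded_measurable_uminus[OF assms(2)]] by simp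

lemma bounded_measurable_power: "bounded_measurable R f \<Longrightarrow> bounded_measurable R (\<lambda>x. f x ^ n)"
  by (induction n) (auto intro: bounded_measurable_const bounded_measurable_mult)

lemma bounded_measurable_sum:
  "(\<And>i. i \<in> I \<Longrightarrow> bounded_measurable R (f i)) \<Longrightarrow> bounded_measurable R (\<lambda>x. \<Sum>i\<in>I. f i x)"
  by (induction I rule: infinite_finite_induct)
     (auto intro: bounded_measurable_const bounded_measurable_add)

lemma bounded_measurable_prod:
  "(\<And>i. i \<in> I \<Longrightarrow> bounded_measurable R (f i)) \<Longrightarrow> bounded_measurable R (\<lambda>x. \<Prod>i\<in>I. f i x)"
  by (induction I rule: infinite_finite_induct)
     (auto intro: bounded_measurable_const bounded_measurable_mult)

lemma bounded_measurable_exp: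
  assumes "bounded_measurable R f"
  shows "bounded_measurable R (\<lambda>x. exp (f x))"
proof -
  obtain A where *: "\<forall>x\<in>space R. \<bar>f x\<bar> \<le> A"
    using assms unfolding bounded_measurable_def by blast
  hence "\<forall>x\<in>space R. \<bar>exp (f x)\<bar> \<le> exp A" by force
  thus ?thesis using assms unfolding bounded_measurable_def by auto
qed

lemma bounded_measurable_indicator: "A \<in> sets R \<Longrightarrow> bounded_measurable R (indicator A)"
  by (rule bounded_measurableI[where B = 1]) (auto split: split_indicator)

lemma bounded_measurable_compose:
  assumes f: "bounded_measurable R f" and h: "h \<in> measurable S R"
  shows "bounded_measurable S (\<lambda>x. f (h x))"
  using assms measurable_space[OF h] measurable_compose[OF h]
  unfolding bounded_measurable_def by blast

lemmas bounded_measurable_intros = bounded_measurable_const bounded_measurable_add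
  bounded_measurable_mult bounded_measurable_diff bounded_measurable_uminus bounded_measurable_abs
  bounded_measurable_power bounded_measurable_sum bounded_measurable_prod bounded_measurable_exp

lemma (in finite_measure) integrable_bounded_measurable:
  assumes "bounded_measurable M f"
  shows "integrable M f"
proof -
  obtain A where "\<forall>x\<in>space M. \<bar>f x\<bar> \<le> A"
    using assms unfolding bounded_measurable_def by blast
  thus ?thesis using assms unfolding bounded_measurable_def
    by (intro integrable_const_bound[where B = A]) auto
qed

lemma bounded_measurable_if_oscillation:
  assumes meas: "f \<in> borel_measurable R" and x0: "x0 \<in> space R"
    and pos: "\<And>x. x \<in> space R \<Longrightarrow> f x > 0"
    and osc: "\<And>x y. x \<in> space R \<Longrightarrow> y \<in> space R \<Longrightarrow> f x \<le> C * f y"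
  shows "bounded_measurable R f" "bounded_measurable R (\<lambda>x. ln (f x))"
proof -
  show "bounded_measurable R f"
    by (rule bounded_measurableI[where B = "C * f x0", OF meas]) (use pos osc x0 in force)
  have C: "C > 0" using osc[OF x0 x0] pos[OF x0] by (metis less_le_trans zero_less_mult_pos2)
  have "\<bar>ln (f x)\<bar> \<le> \<bar>ln (f x0)\<bar> + \<bar>ln C\<bar>" if x: "x \<in> space R" for x
  proof -
    have "ln (f x) \<le> ln (C * f x0)" "ln (f x0) \<le> ln (C * f x)"
      using osc x x0 pos C by (simp_all add: mult_pos_pos)
    moreover have "ln (C * f x0) = ln C + ln (f x0)" "ln (C * f x) = ln C + ln (f x)"
      using C pos[OF x] pos[OF x0] by (auto simp: ln_mult)
    ultimately show ?thesis by linarith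
  qed
  thus "bounded_measurable R (\<lambda>x. ln (f x))"
    using meas by (intro bounded_measurableI) auto
qed

text \<open>Integrating the oscillation inequality in one of its two variables replaces that value
  by the mean 1.\<close>

lemma (in prob_space) bounds_if_oscillation:
  fixes f :: "'a \<Rightarrow> real"
  assumes meas: "f \<in> borel_measurable M"
    and pos: "\<And>x. x \<in> space M \<Longrightarrow> f x > 0"
    and osc: "\<And>x y. x \<in> space M \<Longrightarrow> y \<in> space M \<Longrightarrow> f x \<le> C * f y"
    and int: "(\<integral>x. f x \<partial>M) = 1" and x: "x \<in> space M"
  shows "f x \<le> C" "1 \<le> C * f x"
proof -
  note b = integrable_bounded_measurable[OF bounded_measurable_if_oscillation(1)[OF meas x pos osc]]
  have "(\<integral>y. f x \<partial>M) \<le> (\<integral>y. C * f y \<partial>M)"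
    using osc x by (intro integral_mono b integrable_mult_right) auto
  thus "f x \<le> C" using int by (simp add: prob_space)
  have "(\<integral>y. f y \<partial>M) \<le> (\<integral>y. C * f x \<partial>M)"
    using osc x by (intro integral_mono b integrable_mult_right) auto
  thus "1 \<le> C * f x" using int by (simp add: prob_space)
qed

lemma (in prob_space) square_expectation_le:
  assumes "bounded_measurable M f"
  shows "(\<integral>x. f x \<partial>M)\<^sup>2 \<le> (\<integral>x. (f x)\<^sup>2 \<partial>M)"
proof -
  have "variance f = expectation (\<lambda>x. (f x)\<^sup>2) - (expectation f)\<^sup>2"
    by (intro variance_eq integrable_bounded_measurable bounded_measurable_intros assms)
  thus ?thesis using variance_positive[of f] by simp
qed

lemma (in prob_space) centered_second_moment_le:
  assumes f: "bounded_measurable M f" and 0: "(\<integral>x. f x \<partial>M) = 0"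
  shows "(\<integral>x. (f x)\<^sup>2 \<partial>M) \<le> (\<integral>x. (f x + m)\<^sup>2 \<partial>M)"
proof -
  have i: "integrable M (\<lambda>x. (f x)\<^sup>2)" "integrable M (\<lambda>x. 2 * m * f x)" "integrable M (\<lambda>x. m\<^sup>2)"
    by (intro integrable_bounded_measurable bounded_measurable_intros f)+
  have e: "(\<lambda>x. (f x + m)\<^sup>2) = (\<lambda>x. (f x)\<^sup>2 + (2 * m * f x + m\<^sup>2))"
    by (auto simp: power2_eq_square algebra_simps)
  have "(\<integral>x. (f x + m)\<^sup>2 \<partial>M) = (\<integral>x. (f x)\<^sup>2 \<partial>M) + ((\<integral>x. 2 * m * f x \<partial>M) + (\<integral>x. m\<^sup>2 \<partial>M))"
    unfolding e using i by simp
  thus ?thesis using 0 by (simp add: prob_space)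
qed

subsection \<open>Convergence in \<open>L\<^sup>p\<close>\<close>

lemma (in prob_space) in_Lp_bounded:
  assumes "f \<in> borel_measurable M" "AE x in M. \<bar>f x\<bar> \<le> B" "p \<ge> 1"
  shows "in_Lp p M f"
proof -
  have "integrable M (\<lambda>x. \<bar>f x\<bar> powr p)"
  proof (rule integrable_const_bound[where B = "B powr p"])
    show "AE x in M. norm (\<bar>f x\<bar> powr p) \<le> B powr p"
      using assms(2) by eventually_elim (use assms(3) in \<open>auto intro!: powr_mono2\<close>)
  qed (use assms in auto)
  thus ?thesis using assms by (simp add: in_Lp_def)
qed

text \<open>Dominated convergence: the limit inherits the bound \<open>B\<close>, so the constant
  \<open>(2 * B) powr p\<close> dominates, and one proof serves all exponents.\<close>

lemma (in prob_space) Lp_tendsto_bounded: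
  assumes f: "\<And>n. f n \<in> borel_measurable M" and g: "g \<in> borel_measurable M"
    and bound: "\<And>n. AE x in M. \<bar>f n x\<bar> \<le> B"
    and lim: "AE x in M. (\<lambda>n. f n x) \<longlonglongrightarrow> g x" and p: "p \<ge> 1"
  shows "Lp_tendsto p M f g"
proof -
  have "AE x in M. \<forall>n. \<bar>f n x\<bar> \<le> B" using bound by (simp add: AE_all_countable)
  with lim have gB: "AE x in M. \<bar>g x\<bar> \<le> B"
  proof eventually_elim
    case (elim x)
    show ?case by (rule LIMSEQ_le_const2[OF tendsto_rabs[OF elim(1)]]) (use elim(2) in auto)
  qed
  have "(\<lambda>n. \<integral>x. \<bar>f n x - g x\<bar> powr p \<partial>M) \<longlonglongrightarrow> (\<integral>x. 0 \<partial>M)"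
  proof (rule integral_dominated_convergence[where w = "\<lambda>x. (2 * B) powr p"])
    show "AE x in M. (\<lambda>n. \<bar>f n x - g x\<bar> powr p) \<longlonglongrightarrow> 0"
      using lim
    proof eventually_elim
      case (elim x)
      have "(\<lambda>n. \<bar>f n x - g x\<bar>) \<longlonglongrightarrow> 0" using elim by (simp add: LIM_zero tendsto_rabs_zero)
      hence "(\<lambda>n. \<bar>f n x - g x\<bar> powr p) \<longlonglongrightarrow> 0 powr p"
        by (rule tendsto_powr2) (use p in auto)
      thus ?case using p by simp
    qed
    fix n
    show "AE x in M. norm (\<bar>f n x - g x\<bar> powr p) \<le> (2 * B) powr p"
      using gB bound[of n]
    proof eventually_elim
      case (elim x)
      show ?case using elim p by (auto intro!: powr_mono2)
    qed
  qed (use f g in auto)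
  hence "(\<lambda>n. Lp_norm p M (\<lambda>x. f n x - g x)) \<longlonglongrightarrow> 0 powr (1 / p)"
    unfolding Lp_norm_def using p by (intro tendsto_powr2) auto
  hence "(\<lambda>n. Lp_norm p M (\<lambda>x. f n x - g x)) \<longlonglongrightarrow> 0" by simp
  thus ?thesis unfolding Lp_tendsto_def by (intro conjI allI in_Lp_bounded[OF f bound p] in_Lp_bounded[OF g gB p])
qed

subsection \<open>Relative entropy\<close>

text \<open>For \<open>y > 0\<close> the expression is \<open>y\<close> times the defect in
  \<open>ln t \<le> t - 1\<close> at \<open>t = z / y\<close>, which vanishes only at
  \<open>t = 1\<close>. For \<open>y = 0\<close> it is \<open>z\<close>.\<close>

lemma relative_entropy_density_nonneg:
  fixes y z :: real
  assumes "y \<ge> 0" "z > 0"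
  shows "y * ln (y / z) - y + z \<ge> 0"
    and "y * ln (y / z) - y + z = 0 \<longleftrightarrow> y = z"
proof -
  have *: "y * ln (y / z) - y + z \<ge> 0 \<and> (y * ln (y / z) - y + z = 0 \<longleftrightarrow> y = z)"
  proof (cases "y = 0")
    case False
    hence y: "y > 0" using assms by simp
    have e: "y * ln (y / z) - y + z = y * (z / y - 1 - ln (z / y))"
      using y assms by (simp add: ln_div field_simps)
    have "ln (z / y) \<le> z / y - 1" using y assms by (intro ln_le_minus_one) auto
    moreover have "z / y - 1 - ln (z / y) = 0 \<longleftrightarrow> y = z"
      using ln_eq_minus_one[of "z / y"] y assms by auto
    ultimately show ?thesis unfolding e using y by simp
  qed (use assms in auto)
  thus "y * ln (y / z) - y + z \<ge> 0" "y * ln (y / z) - y + z = 0 \<longleftrightarrow> y = z" by auto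
qed

lemma ereal_integral_cong_AE:
  assumes "AE x in R. f x = g x"
  shows "ereal_integral R f = ereal_integral R g"
proof -
  have "(\<integral>\<^sup>+x. ennreal (f x) \<partial>R) = (\<integral>\<^sup>+x. ennreal (g x) \<partial>R)"
       "(\<integral>\<^sup>+x. ennreal (- f x) \<partial>R) = (\<integral>\<^sup>+x. ennreal (- g x) \<partial>R)"
    using assms by (auto intro!: nn_integral_cong_AE)
  thus ?thesis by (simp add: ereal_integral_def)
qed

lemma ereal_integral_integrable:
  assumes "integrable R f"
  shows "ereal_integral R f = ereal (\<integral>x. f x \<partial>R)"
proof -
  have p: "(\<integral>\<^sup>+x. ennreal (f x) \<partial>R) < \<infinity>" "(\<integral>\<^sup>+x. ennreal (- f x) \<partial>R) < \<infinity>"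
    using real_integrable_def[of R f] assms by (auto simp: top.not_eq_extremum)
  show ?thesis
    unfolding ereal_integral_def real_lebesgue_integral_def[OF assms]
    using p by (cases "\<integral>\<^sup>+x. ennreal (f x) \<partial>R"; cases "\<integral>\<^sup>+x. ennreal (- f x) \<partial>R") auto
qed

text \<open>The delicate case is an infinite integral of \<open>h\<close>. Then the positive part of
  \<open>h + r\<close> has infinite integral because \<open>h\<close> is at most that part plus
  \<bar>r\<bar>, while the negative part is at most \<bar>r\<bar> and stays integrable, so no
  difference of infinities arises.\<close>

lemma ereal_integral_add_nonneg:
  assumes h: "h \<in> borel_measurable R" "\<And>x. x \<in> space R \<Longrightarrow> h x \<ge> 0" and r: "integrable R r"
  shows "ereal_integral R (\<lambda>x. h x + r x) = enn2ereal (\<integral>\<^sup>+x. ennreal (h x) \<partial>R) + ereal (\<integral>x. r x \<partial>R)"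
proof (cases "(\<integral>\<^sup>+x. ennreal (h x) \<partial>R) = \<infinity>")
  case False
  hence i: "integrable R h" using h by (intro integrableI_nonneg) (auto simp: top.not_eq_extremum)
  have "enn2ereal (\<integral>\<^sup>+x. ennreal (h x) \<partial>R) = ereal (\<integral>x. h x \<partial>R)"
    using h by (subst nn_integral_eq_integral[OF i]) (auto intro!: enn2ereal_ennreal integral_nonneg_AE)
  thus ?thesis using ereal_integral_integrable[of R "\<lambda>x. h x + r x"] i r by simp
next
  case True
  have rm: "r \<in> borel_measurable R" using r by auto
  have r1: "(\<integral>\<^sup>+x. ennreal \<bar>r x\<bar> \<partial>R) < \<infinity>" using r by (simp add: integrable_iff_bounded)
  have "(\<integral>\<^sup>+x. ennreal (h x) \<partial>R) \<le> (\<integral>\<^sup>+x. ennreal (h x + r x) + ennreal \<bar>r x\<bar> \<partial>R)"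
    by (intro nn_integral_mono)
       (auto simp: ennreal_plus_if intro!: ennreal_leI)
  also have "\<dots> = (\<integral>\<^sup>+x. ennreal (h x + r x) \<partial>R) + (\<integral>\<^sup>+x. ennreal \<bar>r x\<bar> \<partial>R)"
    using h(1) rm by (intro nn_integral_add) auto
  finally have p: "(\<integral>\<^sup>+x. ennreal (h x + r x) \<partial>R) = \<infinity>"
    using True r1 by (auto simp: top_unique ennreal_add_eq_top)
  have "(\<integral>\<^sup>+x. ennreal (- (h x + r x)) \<partial>R) \<le> (\<integral>\<^sup>+x. ennreal \<bar>r x\<bar> \<partial>R)"
    using h(2) by (intro nn_integral_mono ennreal_leI) force
  hence "(\<integral>\<^sup>+x. ennreal (- (h x + r x)) \<partial>R) < \<infinity>" using r1 by (rule le_less_trans)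
  hence m: "enn2ereal (\<integral>\<^sup>+x. ennreal (- (h x + r x)) \<partial>R) < \<infinity>"
    by (cases "\<integral>\<^sup>+x. ennreal (- (h x + r x)) \<partial>R") auto
  show ?thesis unfolding ereal_integral_def p True using m
    by (cases "enn2ereal (\<integral>\<^sup>+x. ennreal (- (h x + r x)) \<partial>R)") (auto simp: enn2ereal_eq_top_iff)
qed

text \<open>The Radon-Nikodym derivative of a finite measure is infinite only on a null set, so its
  conversion to a real function loses nothing.\<close>

lemma density_real_density:
  assumes R: "prob_space R" and \<gamma>: "prob_space \<gamma>" and ac: "absolutely_continuous R \<gamma>"
    and sets: "sets \<gamma> = sets R"
  shows "density R (\<lambda>x. ennreal (real_density R \<gamma> x)) = \<gamma>"
proof -
  interpret R: prob_space R by fact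
  interpret G: prob_space \<gamma> by fact
  have "AE x in R. RN_deriv R \<gamma> x \<noteq> \<infinity>"
    by (rule R.RN_deriv_finite[OF G.sigma_finite_measure_axioms ac sets])
  hence "AE x in R. ennreal (real_density R \<gamma> x) = RN_deriv R \<gamma> x"
    by eventually_elim (simp add: real_density_def top.not_eq_extremum)
  hence "density R (\<lambda>x. ennreal (real_density R \<gamma> x)) = density R (RN_deriv R \<gamma>)"
    by (intro density_cong) (auto simp: real_density_def)
  thus ?thesis using R.density_RN_deriv[OF ac sets] by simp
qed

lemma real_density_nonneg: "real_density R \<gamma> x \<ge> 0"
  by (simp add: real_density_def)

lemma real_density_measurable [measurable]: "real_density R \<gamma> \<in> borel_measurable R"
  unfolding real_density_def by measurable

lemma (in prob_space) real_density_density: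
  assumes "g \<in> borel_measurable M" "\<And>x. x \<in> space M \<Longrightarrow> 0 \<le> g x"
  shows "AE x in M. real_density M (density M (\<lambda>x. ennreal (g x))) x = g x"
proof -
  have "AE x in M. ennreal (g x) = RN_deriv M (density M (\<lambda>x. ennreal (g x))) x"
    using assms(1) by (intro RN_deriv_unique) auto
  thus ?thesis using AE_space
    by eventually_elim (metis assms(2) enn2real_ennreal real_density_def)
qed

subsection \<open>Integration over all coordinates but one\<close>

text \<open>The cost enters the estimates through one number \<open>K\<close> that bounds the kernel
  above and, inverted, below.\<close>

locale gibbs_kernel = product_prob_space M "{1..N}" for N :: nat and M :: "nat \<Rightarrow> 'a measure" +
  fixes c :: "(nat \<Rightarrow> 'a) \<Rightarrow> real" and \<epsilon> :: real and K :: real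
  assumes kernel_measurable: "gibbs c \<epsilon> \<in> borel_measurable (Pi\<^sub>M {1..N} M)"
    and N: "N \<ge> 1" and K: "K \<ge> 1"
    and kernel_bounds: "\<And>x. x \<in> space (Pi\<^sub>M {1..N} M) \<Longrightarrow> 1 / K \<le> gibbs c \<epsilon> x \<and> gibbs c \<epsilon> x \<le> K"
begin

abbreviation R :: "(nat \<Rightarrow> 'a) measure" where "R \<equiv> Pi\<^sub>M {1..N} M"

abbreviation R_without :: "nat \<Rightarrow> (nat \<Rightarrow> 'a) measure" where
  "R_without j \<equiv> Pi\<^sub>M ({1..N} - {j}) M"

text \<open>For a density on the product this is the density of its \<open>j\<close>-th marginal. It
  is an integral at every single \<open>x\<close> and not a conditional expectation up to null sets,
  which is what pointwise estimates of the increments require.\<close>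

definition marginal :: "nat \<Rightarrow> ((nat \<Rightarrow> 'a) \<Rightarrow> real) \<Rightarrow> 'a \<Rightarrow> real" where
  "marginal j f x = (\<integral>y. f (y(j := x)) \<partial>R_without j)"

lemma prob_space_R: "prob_space R" by unfold_locales

lemma prob_space_M: "prob_space (M i)" by unfold_locales

lemma prob_space_R_without: "prob_space (R_without j)"
  by (intro prob_space_PiM prob_space_M)

lemma space_M_nonempty: "\<exists>x. x \<in> space (M i)"
  using prob_space.not_empty[OF prob_space_M[of i]] by blast

lemma integrable_R: "bounded_measurable R f \<Longrightarrow> integrable R f"
  by (rule finite_measure.integrable_bounded_measurable[OF prob_space.finite_measure[OF prob_space_R]])

lemma integrable_R_without: "bounded_measurable (R_without j) f \<Longrightarrow> integrable (R_without j) f"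
  by (rule finite_measure.integrable_bounded_measurable[OF prob_space.finite_measure[OF prob_space_R_without]])

lemma integrable_M: "bounded_measurable (M i) f \<Longrightarrow> integrable (M i) f"
  by (rule finite_measure.integrable_bounded_measurable[OF prob_space.finite_measure[OF prob_space_M]])

lemma integral_const_prob:
  "(\<integral>x. (a::real) \<partial>R) = a" "(\<integral>x. a \<partial>R_without j) = a" "(\<integral>x. a \<partial>M i) = a"
  using prob_space.prob_space[OF prob_space_R] prob_space.prob_space[OF prob_space_R_without]
    prob_space.prob_space[OF prob_space_M] by simp_all

lemma component_space: "x \<in> space R \<Longrightarrow> i \<in> {1..N} \<Longrightarrow> x i \<in> space (M i)"
  unfolding space_PiM by (rule PiE_mem)

lemma component_space_without: "x \<in> space (R_without j) \<Longrightarrow> i \<in> {1..N} - {j} \<Longrightarrow> x i \<in> space (M i)"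
  unfolding space_PiM by (rule PiE_mem)

lemma update_measurable_pair:
  assumes "j \<in> {1..N}"
  shows "(\<lambda>(y, x). y(j := x)) \<in> measurable (R_without j \<Otimes>\<^sub>M M j) R"
  using measurable_add_dim[of j "{1..N} - {j}" M] assms by (simp add: insert_absorb)

lemma update_measurable:
  assumes "j \<in> {1..N}" "x \<in> space (M j)"
  shows "(\<lambda>y. y(j := x)) \<in> measurable (R_without j) R"
  using measurable_compose[OF measurable_Pair[OF measurable_ident measurable_const[OF assms(2)]]
      update_measurable_pair[OF assms(1)]] by simp

lemma update_space:
  assumes "j \<in> {1..N}" "x \<in> space (M j)" "y \<in> space (R_without j)"
  shows "y(j := x) \<in> space R"
  using measurable_space[OF update_measurable[OF assms(1,2)] assms(3)] .

lemma bounded_measurable_update: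
  assumes "j \<in> {1..N}" "x \<in> space (M j)" "bounded_measurable R f"
  shows "bounded_measurable (R_without j) (\<lambda>y. f (y(j := x)))"
  by (rule bounded_measurable_compose[OF assms(3) update_measurable[OF assms(1,2)]])

lemma bounded_measurable_component:
  assumes "i \<in> J" "bounded_measurable (M i) f"
  shows "bounded_measurable (Pi\<^sub>M J M) (\<lambda>x. f (x i))"
  by (rule bounded_measurable_compose[OF assms(2), of "\<lambda>x. x i"]) (rule measurable_component_singleton[OF assms(1)])

lemma bounded_measurable_kernel: "bounded_measurable R (gibbs c \<epsilon>)"
proof (rule bounded_measurableI[OF kernel_measurable])
  fix x assume "x \<in> space R"
  from kernel_bounds[OF this] K show "\<bar>gibbs c \<epsilon> x\<bar> \<le> K" by (simp add: gibbs_def)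
qed

lemma integral_component:
  assumes "i \<in> J" "f \<in> borel_measurable (M i)"
  shows "(\<integral>x. f (x i) \<partial>Pi\<^sub>M J M) = (\<integral>x. (f x :: real) \<partial>M i)"
proof -
  have "(\<integral>x. f x \<partial>M i) = (\<integral>x. f x \<partial>distr (Pi\<^sub>M J M) (M i) (\<lambda>x. x i))"
    using distr_PiM_component[of J M i] prob_space_M assms(1) by simp
  also have "\<dots> = (\<integral>x. f (x i) \<partial>Pi\<^sub>M J M)"
    using assms by (intro integral_distr) auto
  finally show ?thesis by simp
qed

lemma marginal_measurable:
  assumes j: "j \<in> {1..N}" and f: "f \<in> borel_measurable R"
  shows "marginal j f \<in> borel_measurable (M j)"
proof -
  interpret S: prob_space "R_without j" by (rule prob_space_R_without)
  have "(\<lambda>(x, y). f (y(j := x))) \<in> borel_measurable (M j \<Otimes>\<^sub>M R_without j)"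
    using measurable_compose[OF measurable_compose[OF measurable_pair_swap' update_measurable_pair[OF j]] f]
    by (simp add: case_prod_beta)
  thus ?thesis unfolding marginal_def by (rule S.borel_measurable_lebesgue_integral)
qed

lemma marginal_mono:
  assumes "j \<in> {1..N}" "x \<in> space (M j)" "bounded_measurable R f" "bounded_measurable R g"
    and "\<And>y. y \<in> space R \<Longrightarrow> f y \<le> g y"
  shows "marginal j f x \<le> marginal j g x"
  unfolding marginal_def
  by (intro integral_mono integrable_R_without bounded_measurable_update assms update_space)

lemma marginal_const: "marginal j (\<lambda>x. a) x = a"
  by (simp only: marginal_def integral_const_prob)

lemma integral_marginal:
  assumes j: "j \<in> {1..N}" and f: "bounded_measurable R f"
  shows "(\<integral>x. marginal j f x \<partial>M j) = (\<integral>x. f x \<partial>R)"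
proof -
  interpret S: prob_space "R_without j" by (rule prob_space_R_without)
  interpret T: prob_space "M j" by (rule prob_space_M)
  interpret P: pair_sigma_finite "R_without j" "M j" ..
  interpret P2: prob_space "R_without j \<Otimes>\<^sub>M M j" by (intro prob_space_pair prob_space_M prob_space_R_without)
  have i: "insert j ({1..N} - {j}) = {1..N}" using j by auto
  have "(\<integral>x. f x \<partial>R) = (\<integral>y. (\<integral>x. f (y(j := x)) \<partial>M j) \<partial>R_without j)"
    using product_integral_insert[of "{1..N} - {j}" j f] integrable_R[OF f] unfolding i by simp
  also have "\<dots> = (\<integral>x. (\<integral>y. f (y(j := x)) \<partial>R_without j) \<partial>M j)"
    using bounded_measurable_compose[OF f update_measurable_pair[OF j]]
    by (intro P.Fubini_integral[symmetric] P2.integrable_bounded_measurable) (simp add: case_prod_beta')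
  finally show ?thesis by (simp add: marginal_def)
qed

lemma marginal_mult_component:
  "marginal j (\<lambda>z. g (z j) * f z) x = g x * marginal j f x"
  by (simp add: marginal_def)

lemma integral_mult_component:
  assumes j: "j \<in> {1..N}" and f: "bounded_measurable R f" and g: "bounded_measurable (M j) g"
  shows "(\<integral>x. g (x j) * f x \<partial>R) = (\<integral>x. g x * marginal j f x \<partial>M j)"
  using integral_marginal[OF j bounded_measurable_mult[OF bounded_measurable_component[OF j g] f]]
  by (simp add: marginal_mult_component)

text \<open>Functions of distinct coordinates with mean zero are orthogonal.\<close>

lemma sum_centered_squares:
  assumes g: "\<And>i. i \<in> {1..N} \<Longrightarrow> bounded_measurable (M i) (g i)"
    and 0: "\<And>i. i \<in> {1..N} \<Longrightarrow> (\<integral>x. g i x \<partial>M i) = 0"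
  shows "(\<Sum>i\<in>{1..N}. \<integral>x. (g i x)\<^sup>2 \<partial>M i) \<le> (\<integral>x. ((\<Sum>i\<in>{1..N}. g i (x i)) + m)\<^sup>2 \<partial>R)"
proof -
  let ?S = "\<lambda>x. \<Sum>i\<in>{1..N}. g i (x i)"
  have b: "bounded_measurable R (\<lambda>x. g i (x i))" if "i \<in> {1..N}" for i
    by (intro bounded_measurable_component that g)
  have S: "bounded_measurable R ?S" by (intro bounded_measurable_intros b)
  have zero: "(\<integral>x. g i (x i) \<partial>R) = 0" if "i \<in> {1..N}" for i
    using integral_component[OF that bounded_measurable_measurable[OF g[OF that]]] 0[OF that] by simp
  have gg: "(\<integral>x. g i (x i) * g j (x j) \<partial>R) = (if i = j then \<integral>x. (g i x)\<^sup>2 \<partial>M i else 0)"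
    if i: "i \<in> {1..N}" and j: "j \<in> {1..N}" for i j
  proof (cases "i = j")
    case True
    have "(\<lambda>x. (g i x)\<^sup>2) \<in> borel_measurable (M i)"
      using bounded_measurable_measurable[OF g[OF i]] by simp
    from integral_component[OF i this] show ?thesis using True by (simp add: power2_eq_square)
  next
    case False
    \<comment> \<open>The function does not depend on coordinate \<open>i\<close>, so its marginal
      there is constant and equal to its mean.\<close>
    have "marginal i (\<lambda>z. g j (z j)) x = 0" for x
      using integral_component[of j "{1..N} - {i}" "g j"] bounded_measurable_measurable[OF g[OF j]]
        0[OF j] False j by (simp add: marginal_def)
    thus ?thesis using integral_mult_component[OF i b[OF j] g[OF i]] False by simp
  qed
  have bb: "bounded_measurable R (\<lambda>x. g i (x i) * g j (x j))" if "i \<in> {1..N}" "j \<in> {1..N}" for i j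
    using that by (intro bounded_measurable_mult b)
  have "(\<integral>x. (?S x)\<^sup>2 \<partial>R) = (\<integral>x. (\<Sum>i\<in>{1..N}. \<Sum>j\<in>{1..N}. g i (x i) * g j (x j)) \<partial>R)"
    by (simp only: power2_eq_square sum_product)
  also have "\<dots> = (\<Sum>i\<in>{1..N}. \<integral>x. (\<Sum>j\<in>{1..N}. g i (x i) * g j (x j)) \<partial>R)"
    by (rule Bochner_Integration.integral_sum, intro integrable_R bounded_measurable_sum bb)
  also have "\<dots> = (\<Sum>i\<in>{1..N}. \<Sum>j\<in>{1..N}. \<integral>x. g i (x i) * g j (x j) \<partial>R)"
    by (rule sum.cong[OF refl], rule Bochner_Integration.integral_sum, intro integrable_R bb)
  also have "\<dots> = (\<Sum>i\<in>{1..N}. \<integral>x. (g i x)\<^sup>2 \<partial>M i)"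
    by (rule sum.cong[OF refl]) (simp add: gg del: atLeastAtMost_iff One_nat_def cong: sum.cong)
  finally have sq: "(\<integral>x. (?S x)\<^sup>2 \<partial>R) = (\<Sum>i\<in>{1..N}. \<integral>x. (g i x)\<^sup>2 \<partial>M i)" .
  have "(\<integral>x. ?S x \<partial>R) = (\<Sum>i\<in>{1..N}. \<integral>x. g i (x i) \<partial>R)"
    by (rule Bochner_Integration.integral_sum, intro integrable_R b)
  hence S0: "(\<integral>x. ?S x \<partial>R) = 0" using zero by simp
  \<comment> \<open>The sum is centred, so shifting it by \<open>m\<close> can only increase the
    second moment.\<close>
  show ?thesis
    using prob_space.centered_second_moment_le[OF prob_space_R S S0, of m] unfolding sq .
qed

subsection \<open>Gibbs densities and the Harnack bound\<close>

definition gibbs_density :: "(nat \<Rightarrow> 'a \<Rightarrow> real) \<Rightarrow> (nat \<Rightarrow> 'a) \<Rightarrow> real" where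
  "gibbs_density b x = (\<Prod>i\<in>{1..N}. b i (x i)) * gibbs c \<epsilon> x"

definition partial_mass :: "nat \<Rightarrow> (nat \<Rightarrow> 'a \<Rightarrow> real) \<Rightarrow> 'a \<Rightarrow> real" where
  "partial_mass j b x =
     (\<integral>y. (\<Prod>i\<in>{1..N} - {j}. b i (y i)) * gibbs c \<epsilon> (y(j := x)) \<partial>R_without j)"

text \<open>Every Sinkhorn update satisfies the inequality with the square of \<open>K\<close>, whatever the other
  potentials are; this is what makes all later constants independent of the iteration.\<close>

definition harnack :: "nat \<Rightarrow> ('a \<Rightarrow> real) \<Rightarrow> bool" where
  "harnack i f \<longleftrightarrow> f \<in> borel_measurable (M i) \<and> (\<forall>x\<in>space (M i). 0 < f x) \<and>
     (\<forall>x\<in>space (M i). \<forall>y\<in>space (M i). f x \<le> K\<^sup>2 * f y)"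

text \<open>One factor \<open>K\<^sup>2\<close> for the oscillation of each of the \<open>N\<close>
  potentials and one for the kernel.\<close>

definition harnack_const :: real ("B") where "B = (K\<^sup>2) ^ N * K\<^sup>2"

text \<open>Bounds the logarithm of the ratio of two densities that both lie between
  \<open>1 / B\<close> and \<open>B\<close>.\<close>

definition log_const :: real ("D") where "D = 2 * ln B"

lemma kernel_pos: "0 < gibbs c \<epsilon> x"
  by (simp add: gibbs_def)

lemma B_ge_1: "B \<ge> 1"
  using K by (simp add: harnack_const_def one_le_power mult_ge1_I)

lemma D_nonneg: "D \<ge> 0" and ln_B_le_D: "ln B \<le> D"
  using B_ge_1 by (simp_all add: log_const_def)

lemma harnack_pos: "harnack i f \<Longrightarrow> x \<in> space (M i) \<Longrightarrow> 0 < f x"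
  by (auto simp: harnack_def)

lemma harnack_measurable: "harnack i f \<Longrightarrow> f \<in> borel_measurable (M i)"
  by (auto simp: harnack_def)

lemma harnack_bounded_measurable:
  assumes "harnack i f"
  shows "bounded_measurable (M i) f" "bounded_measurable (M i) (\<lambda>x. ln (f x))"
proof -
  obtain x0 where "x0 \<in> space (M i)" using space_M_nonempty by blast
  note * = bounded_measurable_if_oscillation[OF _ this, where f = f and C = "K\<^sup>2"]
  show "bounded_measurable (M i) f" "bounded_measurable (M i) (\<lambda>x. ln (f x))"
    using assms unfolding harnack_def by (auto intro!: *)
qed

lemma gibbs_density_pos:
  assumes "\<And>i. i \<in> {1..N} \<Longrightarrow> harnack i (b i)" "x \<in> space R"
  shows "0 < gibbs_density b x"
  unfolding gibbs_density_def
  by (intro mult_pos_pos kernel_pos prod_pos harnack_pos[OF assms(1)] component_space[OF assms(2)])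

lemma bounded_measurable_gibbs_density:
  assumes "\<And>i. i \<in> {1..N} \<Longrightarrow> harnack i (b i)"
  shows "bounded_measurable R (gibbs_density b)"
  unfolding gibbs_density_def
  by (intro bounded_measurable_mult bounded_measurable_prod bounded_measurable_kernel)
     (rule bounded_measurable_component, simp, intro harnack_bounded_measurable assms, simp)

lemma gibbs_density_oscillation:
  assumes b: "\<And>i. i \<in> {1..N} \<Longrightarrow> harnack i (b i)" and x: "x \<in> space R" and y: "y \<in> space R"
  shows "gibbs_density b x \<le> B * gibbs_density b y"
proof -
  have "(\<Prod>i\<in>{1..N}. b i (x i)) \<le> (\<Prod>i\<in>{1..N}. K\<^sup>2 * b i (y i))"
  proof (rule prod_mono)
    fix i assume i: "i \<in> {1..N}"
    show "0 \<le> b i (x i) \<and> b i (x i) \<le> K\<^sup>2 * b i (y i)"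
      using b[OF i] component_space[OF x i] component_space[OF y i]
      unfolding harnack_def by (auto intro: less_imp_le)
  qed
  also have "\<dots> = (K\<^sup>2) ^ N * (\<Prod>i\<in>{1..N}. b i (y i))" by (simp add: prod.distrib)
  finally have 1: "(\<Prod>i\<in>{1..N}. b i (x i)) \<le> (K\<^sup>2) ^ N * (\<Prod>i\<in>{1..N}. b i (y i))" .
  have "K * (1 / K) \<le> K * gibbs c \<epsilon> y" using kernel_bounds[OF y] K by (intro mult_left_mono) auto
  hence "K * 1 \<le> K * (K * gibbs c \<epsilon> y)" using K by (intro mult_left_mono) auto
  hence 2: "gibbs c \<epsilon> x \<le> K\<^sup>2 * gibbs c \<epsilon> y"
    using kernel_bounds[OF x] by (simp add: power2_eq_square mult.assoc)
  have "gibbs_density b x \<le> ((K\<^sup>2) ^ N * (\<Prod>i\<in>{1..N}. b i (y i))) * (K\<^sup>2 * gibbs c \<epsilon> y)"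
    unfolding gibbs_density_def
  proof (rule mult_mono[OF 1 2])
    have "0 \<le> (\<Prod>i\<in>{1..N}. b i (y i))"
      by (intro prod_nonneg less_imp_le harnack_pos[OF b] component_space[OF y])
    thus "0 \<le> (K\<^sup>2) ^ N * (\<Prod>i\<in>{1..N}. b i (y i))" by simp
  qed (simp add: gibbs_def)
  thus ?thesis by (simp add: gibbs_density_def harnack_const_def mult_ac)
qed

lemma gibbs_density_bounds:
  assumes b: "\<And>i. i \<in> {1..N} \<Longrightarrow> harnack i (b i)" and int: "(\<integral>x. gibbs_density b x \<partial>R) = 1"
    and x: "x \<in> space R"
  shows "gibbs_density b x \<le> B" "1 / B \<le> gibbs_density b x"
proof -
  note * = prob_space.bounds_if_oscillation[OF prob_space_R, of "gibbs_density b" B x]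
  show "gibbs_density b x \<le> B"
    using bounded_measurable_gibbs_density[OF b] gibbs_density_pos[OF b] gibbs_density_oscillation[OF b] int x
    by (intro *) (auto intro: bounded_measurable_measurable)
  have "1 \<le> B * gibbs_density b x"
    using bounded_measurable_gibbs_density[OF b] gibbs_density_pos[OF b] gibbs_density_oscillation[OF b] int x
    by (intro *) (auto intro: bounded_measurable_measurable)
  thus "1 / B \<le> gibbs_density b x" using B_ge_1 by (simp add: field_simps)
qed

lemma gibbs_density_exp:
  assumes "\<And>i. i \<in> {1..N} \<Longrightarrow> harnack i (b i)" "x \<in> space R"
  shows "gibbs_density b x = exp (\<Sum>i\<in>{1..N}. ln (b i (x i))) * gibbs c \<epsilon> x"
proof -
  have "(\<Prod>i\<in>{1..N}. b i (x i)) = (\<Prod>i\<in>{1..N}. exp (ln (b i (x i))))"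
    by (intro prod.cong refl) (simp only: exp_ln[OF harnack_pos[OF assms(1) component_space[OF assms(2)]]])
  thus ?thesis by (simp add: gibbs_density_def exp_sum)
qed

lemma gibbs_density_cong:
  "(\<And>i. i \<in> {1..N} \<Longrightarrow> b i = b' i) \<Longrightarrow> gibbs_density b = gibbs_density b'"
  unfolding gibbs_density_def by (auto intro!: ext prod.cong)

lemma partial_mass_cong:
  "(\<And>i. i \<in> {1..N} - {j} \<Longrightarrow> b i = b' i) \<Longrightarrow> partial_mass j b = partial_mass j b'"
  unfolding partial_mass_def by (intro ext Bochner_Integration.integral_cong refl) (auto intro!: prod.cong)

lemma marginal_gibbs_density:
  assumes "j \<in> {1..N}"
  shows "marginal j (gibbs_density b) x = b j x * partial_mass j b x"
proof -
  have "gibbs_density b (y(j := x)) = b j x * ((\<Prod>i\<in>{1..N} - {j}. b i (y i)) * gibbs c \<epsilon> (y(j := x)))" for y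
    unfolding gibbs_density_def using assms by (subst prod.remove[of _ j]) auto
  thus ?thesis by (simp add: marginal_def partial_mass_def)
qed

text \<open>The kernel bounds trap the partial mass at every \<open>x\<close> between
  \<open>w / K\<close> and \<open>K * w\<close>, where \<open>w\<close> is the integral of the
  product of the other potentials. Since \<open>w\<close> does not depend on \<open>x\<close>, it
  cancels from the ratio of two values, leaving \<open>K\<^sup>2\<close>.\<close>

lemma sinkhorn_update:
  assumes j: "j \<in> {1..N}" and b: "\<And>i. i \<in> {1..N} - {j} \<Longrightarrow> harnack i (b i)"
  shows "harnack j (\<lambda>x. 1 / partial_mass j b x)"
    and "x \<in> space (M j) \<Longrightarrow> 0 < partial_mass j b x"
proof -
  define P where "P y = (\<Prod>i\<in>{1..N} - {j}. b i (y i))" for y :: "nat \<Rightarrow> 'a"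
  have pm: "partial_mass j b = marginal j (\<lambda>z. P z * gibbs c \<epsilon> z)"
    unfolding partial_mass_def marginal_def P_def
    by (intro ext Bochner_Integration.integral_cong refl arg_cong2[of _ _ _ _ "(*)"] prod.cong) auto
  have bl: "bounded_measurable (M i) (b i)" "bounded_measurable (M i) (\<lambda>x. ln (b i x))"
    if "i \<in> {1..N} - {j}" for i
    using harnack_bounded_measurable[OF b[OF that]] .
  have "bounded_measurable R (\<lambda>x. b i (x i))" if i: "i \<in> {1..N} - {j}" for i
    using i by (intro bounded_measurable_component bl) auto
  hence PR: "bounded_measurable R (\<lambda>z. P z * gibbs c \<epsilon> z)"
    unfolding P_def by (intro bounded_measurable_mult bounded_measurable_prod bounded_measurable_kernel)
  have PW: "bounded_measurable (R_without j) P"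
    unfolding P_def by (intro bounded_measurable_prod bounded_measurable_component bl)
  \<comment> \<open>Pointwise positivity of the product is strengthened to a positive lower bound,
    read off from its bounded logarithm; this makes \<open>w\<close> strictly positive.\<close>
  have "bounded_measurable (R_without j) (\<lambda>y. \<Sum>i\<in>{1..N} - {j}. ln (b i (y i)))"
    by (intro bounded_measurable_sum bounded_measurable_component[where f = "\<lambda>x. ln (b _ x)"] bl)
  then obtain A where A: "\<And>y. y \<in> space (R_without j) \<Longrightarrow> \<bar>\<Sum>i\<in>{1..N} - {j}. ln (b i (y i))\<bar> \<le> A"
    unfolding bounded_measurable_def by blast
  have P_lower: "exp (- A) \<le> P y" if y: "y \<in> space (R_without j)" for y
  proof -
    have "P y = (\<Prod>i\<in>{1..N} - {j}. exp (ln (b i (y i))))"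
      unfolding P_def
      by (intro prod.cong refl) (simp only: exp_ln[OF harnack_pos[OF b component_space_without[OF y]]])
    also have "\<dots> = exp (\<Sum>i\<in>{1..N} - {j}. ln (b i (y i)))" by (simp add: exp_sum)
    finally show ?thesis using A[OF y] by simp
  qed
  define w where "w = (\<integral>y. P y \<partial>R_without j)"
  have "(\<integral>y. exp (- A) \<partial>R_without j) \<le> w"
    unfolding w_def using P_lower
    by (intro integral_mono integrable_R_without PW bounded_measurable_const)
  hence w: "0 < w" unfolding integral_const_prob using exp_gt_zero[of "- A"] by linarith
  have PP: "0 \<le> P y" if "y \<in> space (R_without j)" for y
    using P_lower[OF that] exp_gt_zero[of "- A"] by linarith
  have Pupd: "P (y(j := x)) = P y" for y x
    unfolding P_def by (intro prod.cong) auto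
  have up: "partial_mass j b x \<le> K * w" and lo: "w / K \<le> partial_mass j b x" if x: "x \<in> space (M j)" for x
  proof -
    note bmu = bounded_measurable_update[OF j x PR]
    have "partial_mass j b x \<le> (\<integral>y. K * P y \<partial>R_without j)"
      unfolding pm marginal_def
    proof (intro integral_mono integrable_R_without bmu bounded_measurable_mult bounded_measurable_const PW)
      fix y assume y: "y \<in> space (R_without j)"
      show "P (y(j := x)) * gibbs c \<epsilon> (y(j := x)) \<le> K * P y"
        unfolding Pupd using kernel_bounds[OF update_space[OF j x y]] PP[OF y]
        by (subst mult.commute, intro mult_right_mono) auto
    qed
    thus "partial_mass j b x \<le> K * w" by (simp add: w_def)
    have "(\<integral>y. (1 / K) * P y \<partial>R_without j) \<le> partial_mass j b x"
      unfolding pm marginal_def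
    proof (intro integral_mono integrable_R_without bmu bounded_measurable_mult bounded_measurable_const PW)
      fix y assume y: "y \<in> space (R_without j)"
      show "(1 / K) * P y \<le> P (y(j := x)) * gibbs c \<epsilon> (y(j := x))"
        unfolding Pupd using kernel_bounds[OF update_space[OF j x y]] PP[OF y]
        by (subst (2) mult.commute, intro mult_right_mono) auto
    qed
    thus "w / K \<le> partial_mass j b x" by (simp add: w_def)
  qed
  have pos: "0 < partial_mass j b x" if "x \<in> space (M j)" for x
    using lo[OF that] w K by (smt (verit) divide_pos_pos)
  show "x \<in> space (M j) \<Longrightarrow> 0 < partial_mass j b x" by (rule pos)
  show "harnack j (\<lambda>x. 1 / partial_mass j b x)"
    unfolding harnack_def
  proof (intro conjI ballI)
    have "partial_mass j b \<in> borel_measurable (M j)"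
      unfolding pm by (intro marginal_measurable j bounded_measurable_measurable PR)
    thus "(\<lambda>x. 1 / partial_mass j b x) \<in> borel_measurable (M j)" by simp
  next
    fix x assume x: "x \<in> space (M j)"
    show "0 < 1 / partial_mass j b x" using pos[OF x] by simp
    fix y assume y: "y \<in> space (M j)"
    have "partial_mass j b y \<le> K * (K * partial_mass j b x)"
      using up[OF y] lo[OF x] K by (smt (verit) mult_left_mono divide_le_eq mult.commute)
    thus "1 / partial_mass j b x \<le> K\<^sup>2 * (1 / partial_mass j b y)"
      using pos[OF x] pos[OF y] by (simp add: field_simps power2_eq_square)
  qed
qed

subsection \<open>The iteration\<close>

text \<open>As a simplification rule the second equation of \<open>ipfp\<close> loops: its right-hand side mentions
  \<open>ipfp\<close> at \<open>Suc n\<close> for a bound index.\<close>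

declare ipfp.simps [simp del]

abbreviation potential :: "nat \<Rightarrow> nat \<Rightarrow> 'a \<Rightarrow> real" where
  "potential n i \<equiv> ipfp N M c \<epsilon> n i"

text \<open>\<open>sweep n j\<close> is the tuple reached in sweep \<open>n + 1\<close> after the coordinates \<open>1, \<dots>, j\<close> have been
  updated.\<close>

definition sweep :: "nat \<Rightarrow> nat \<Rightarrow> nat \<Rightarrow> 'a \<Rightarrow> real" where
  "sweep n j i = potential (if i \<le> j then Suc n else n) i"

definition increment :: "nat \<Rightarrow> nat \<Rightarrow> 'a \<Rightarrow> real" where
  "increment n i x = ln (potential (Suc n) i x) - ln (potential n i x)"

abbreviation W :: "nat \<Rightarrow> nat \<Rightarrow> (nat \<Rightarrow> 'a) \<Rightarrow> real" where
  "W n j \<equiv> gibbs_density (sweep n j)"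

text \<open>Using the tuple after the update on the right is not circular:
  \<open>partial_mass j\<close> never looks at entry \<open>j\<close>. Entries below
  \<open>j\<close> are already new and those above are still old, as in the definition of the
  iteration.\<close>

lemma potential_Suc:
  assumes "j \<in> {1..N}"
  shows "potential (Suc n) j = (\<lambda>x. 1 / partial_mass j (sweep n j) x)"
proof -
  have "(\<Prod>i\<in>{1..N} - {j}. sweep n j i (y i)) =
      (\<Prod>i\<in>{1..<j}. potential (Suc n) i (y i)) * (\<Prod>i\<in>{j<..N}. potential n i (y i))" for y
  proof -
    have U: "{1..N} - {j} = {1..<j} \<union> {j<..N}" using assms by auto
    have "(\<Prod>i\<in>{1..N} - {j}. sweep n j i (y i)) =
        (\<Prod>i\<in>{1..<j}. sweep n j i (y i)) * (\<Prod>i\<in>{j<..N}. sweep n j i (y i))"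
      unfolding U by (rule prod.union_disjoint) auto
    also have "(\<Prod>i\<in>{1..<j}. sweep n j i (y i)) = (\<Prod>i\<in>{1..<j}. potential (Suc n) i (y i))"
      unfolding sweep_def by (intro prod.cong) auto
    also have "(\<Prod>i\<in>{j<..N}. sweep n j i (y i)) = (\<Prod>i\<in>{j<..N}. potential n i (y i))"
      unfolding sweep_def by (intro prod.cong) auto
    finally show ?thesis .
  qed
  thus ?thesis by (subst ipfp.simps(2)) (simp only: partial_mass_def)
qed

text \<open>The inner induction on the coordinate is needed because an update uses the potentials of
  smaller index from the same sweep.\<close>

lemma harnack_potential: "i \<in> {1..N} \<Longrightarrow> harnack i (potential n i)"
proof (induction n arbitrary: i)
  case 0
  have "1 \<le> K\<^sup>2" using K by (simp add: one_le_power)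
  thus ?case by (simp add: harnack_def ipfp.simps(1))
next
  case (Suc n)
  from Suc.prems show ?case
  proof (induction i rule: less_induct)
    case (less i)
    have "harnack l (sweep n i l)" if "l \<in> {1..N} - {i}" for l
      using less.IH[of l] Suc.IH[of l] that by (cases "l \<le> i") (auto simp: sweep_def)
    from sinkhorn_update(1)[OF less.prems this] show ?case
      unfolding potential_Suc[OF less.prems] .
  qed
qed

lemma harnack_sweep: "i \<in> {1..N} \<Longrightarrow> harnack i (sweep n j i)"
  unfolding sweep_def by (rule harnack_potential)

lemma potential_pos: "i \<in> {1..N} \<Longrightarrow> x \<in> space (M i) \<Longrightarrow> 0 < potential n i x"
  by (rule harnack_pos[OF harnack_potential])

lemma bounded_measurable_increment:
  "i \<in> {1..N} \<Longrightarrow> bounded_measurable (M i) (increment n i)"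
  unfolding increment_def
  by (intro bounded_measurable_diff harnack_bounded_measurable harnack_potential)

lemmas bounded_measurable_W = bounded_measurable_gibbs_density[OF harnack_sweep]

lemma W_last: "W n N = W (Suc n) 0"
  by (rule gibbs_density_cong) (auto simp: sweep_def)

lemma marginal_W_after:
  assumes j: "j \<in> {1..N}" and x: "x \<in> space (M j)"
  shows "marginal j (W n j) x = 1"
proof -
  have "0 < partial_mass j (sweep n j) x" by (intro sinkhorn_update(2)[OF j _ x] harnack_sweep) auto
  moreover have "sweep n j j = potential (Suc n) j" by (simp only: sweep_def order_refl if_True)
  ultimately show ?thesis
    unfolding marginal_gibbs_density[OF j] potential_Suc[OF j] by simp
qed

text \<open>An update divides the potential by the current marginal, so the increment is minus the
  logarithm of that marginal: it measures how far the constraint is violated just before being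
  repaired.\<close>

lemma marginal_W_before:
  assumes j: "j \<in> {1..N}" and x: "x \<in> space (M j)"
  shows "marginal j (W n (j - 1)) x = exp (- increment n j x)"
proof -
  have pm: "partial_mass j (sweep n (j - 1)) = partial_mass j (sweep n j)"
    by (rule partial_mass_cong) (auto simp: sweep_def)
  have "sweep n (j - 1) j = potential n j"
    using j by (auto simp: sweep_def)
  hence "marginal j (W n (j - 1)) x = potential n j x / potential (Suc n) j x"
    unfolding marginal_gibbs_density[OF j] pm potential_Suc[OF j] by simp
  also have "\<dots> = exp (ln (potential n j x) - ln (potential (Suc n) j x))"
    unfolding exp_diff by (simp only: exp_ln[OF potential_pos[OF j x]])
  finally show ?thesis by (simp add: increment_def)
qed

lemma integral_W_after: "j \<in> {1..N} \<Longrightarrow> (\<integral>x. W n j x \<partial>R) = 1"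
proof -
  assume j: "j \<in> {1..N}"
  have "(\<integral>x. W n j x \<partial>R) = (\<integral>x. marginal j (W n j) x \<partial>M j)"
    by (rule integral_marginal[OF j bounded_measurable_W, symmetric])
  also have "\<dots> = (\<integral>x. 1 \<partial>M j)"
    by (intro Bochner_Integration.integral_cong refl marginal_W_after j)
  finally show ?thesis by (simp only: integral_const_prob)
qed

text \<open>The excluded pair \<open>n = 0\<close>, \<open>j = 0\<close> is the one stage at which
  nothing has been normalised yet.\<close>

lemma integral_W:
  assumes "j \<le> N" "n \<ge> 1 \<or> j \<ge> 1"
  shows "(\<integral>x. W n j x \<partial>R) = 1"
proof (cases "j = 0")
  case True
  then obtain m where "n = Suc m" using assms by (cases n) auto
  thus ?thesis using integral_W_after[of N m] N True by (simp add: W_last)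
qed (use integral_W_after[of j n] assms in auto)

section \<open>Uniform bounds along the iteration\<close>

lemma W_pos: "x \<in> space R \<Longrightarrow> 0 < W n j x"
  by (rule gibbs_density_pos[OF harnack_sweep])

lemma W_bounds:
  assumes "j \<le> N" and x: "x \<in> space R"
  shows "W n j x \<le> B" "1 / B \<le> W n j x"
proof -
  have "W n j x \<le> B \<and> 1 / B \<le> W n j x"
  proof (cases "n \<ge> 1 \<or> j \<ge> 1")
    case True
    show ?thesis using gibbs_density_bounds[OF harnack_sweep integral_W[OF assms(1) True] x] by blast
  next
    \<comment> \<open>Before any update the density is the kernel itself, for which
      \<open>K \<le> B\<close> suffices.\<close>
    case False
    hence "n = 0" "j = 0" by auto
    hence "W n j x = gibbs c \<epsilon> x"
      unfolding gibbs_density_def sweep_def by (simp add: prod.neutral ipfp.simps(1))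
    moreover have "1 * K \<le> (K\<^sup>2) ^ N * K\<^sup>2"
      using K by (intro mult_mono one_le_power) (auto simp: power2_eq_square mult_ge1_I)
    hence "K \<le> B" "1 / B \<le> 1 / K" using K by (auto simp: harnack_const_def intro!: divide_left_mono)
    ultimately show ?thesis using kernel_bounds[OF x] by linarith
  qed
  thus "W n j x \<le> B" "1 / B \<le> W n j x" by auto
qed

lemma ln_W_bound:
  assumes "j \<le> N" "x \<in> space R"
  shows "\<bar>ln (W n j x)\<bar> \<le> ln B"
proof -
  have "ln (W n j x) \<le> ln B" using W_bounds[OF assms] W_pos[OF assms(2)] B_ge_1 by simp
  moreover have "ln (1 / B) \<le> ln (W n j x)" using W_bounds[OF assms] W_pos[OF assms(2)] B_ge_1
    by (subst ln_le_cancel_iff) auto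
  ultimately show ?thesis using B_ge_1 by (simp add: ln_div)
qed

lemma increment_bound:
  assumes j: "j \<in> {1..N}" and x: "x \<in> space (M j)"
  shows "\<bar>increment n j x\<bar> \<le> D"
proof -
  have jN: "j - 1 \<le> N" using j by auto
  have "marginal j (W n (j - 1)) x \<le> marginal j (\<lambda>x. B) x"
    using W_bounds[OF jN] by (intro marginal_mono j x bounded_measurable_W bounded_measurable_const)
  moreover have "marginal j (\<lambda>x. 1 / B) x \<le> marginal j (W n (j - 1)) x"
    using W_bounds[OF jN] by (intro marginal_mono j x bounded_measurable_W bounded_measurable_const)
  ultimately have "exp (- increment n j x) \<le> B" "1 / B \<le> exp (- increment n j x)"
    unfolding marginal_const marginal_W_before[OF j x] by auto
  hence "ln (exp (- increment n j x)) \<le> ln B" "ln (1 / B) \<le> ln (exp (- increment n j x))"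
    using B_ge_1 by (auto simp del: ln_exp)
  hence "\<bar>increment n j x\<bar> \<le> ln B" using B_ge_1 by (simp add: ln_div)
  thus ?thesis using ln_B_le_D by linarith
qed

lemma W_ratio:
  assumes "x \<in> space R"
  shows "W m i x = W n j x * exp (\<Sum>l\<in>{1..N}. ln (sweep m i l (x l)) - ln (sweep n j l (x l)))"
  using gibbs_density_exp[of "sweep m i" x, OF harnack_sweep assms]
    gibbs_density_exp[of "sweep n j" x, OF harnack_sweep assms]
  by (simp add: sum_subtractf exp_diff)

text \<open>The bound comes from the densities, whose logarithms lie within \<open>ln B\<close> of
  zero. Only the sum is controlled here: at this point the single potentials could still drift apart
  along the gauge directions.\<close>

lemma W_log_ratio_bound:
  assumes "i \<le> N" "j \<le> N" and x: "x \<in> space R"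
  shows "\<bar>\<Sum>l\<in>{1..N}. ln (sweep m i l (x l)) - ln (sweep n j l (x l))\<bar> \<le> D"
proof -
  have "ln (W m i x) = ln (W n j x) + (\<Sum>l\<in>{1..N}. ln (sweep m i l (x l)) - ln (sweep n j l (x l)))"
    unfolding W_ratio[OF x, of m i n j] using W_pos[OF x, of n j] by (simp add: ln_mult)
  thus ?thesis using ln_W_bound[OF assms(1) x, of m] ln_W_bound[OF assms(2) x, of n]
    unfolding log_const_def by linarith
qed

lemma W_difference_bound:
  assumes "i \<le> N" "j \<le> N" and x: "x \<in> space R"
  shows "\<bar>W m i x - W n j x\<bar> \<le>
    B * exp D * (\<Sum>l\<in>{1..N}. \<bar>ln (sweep m i l (x l)) - ln (sweep n j l (x l))\<bar>)"
proof -
  define u where "u = (\<Sum>l\<in>{1..N}. ln (sweep m i l (x l)) - ln (sweep n j l (x l)))"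
  have "W m i x - W n j x = W n j x * (exp u - 1)"
    unfolding W_ratio[OF x, of m i n j] u_def[symmetric] by (simp add: algebra_simps)
  hence "\<bar>W m i x - W n j x\<bar> = W n j x * \<bar>exp u - 1\<bar>"
    using W_pos[OF x, of n j] by (simp add: abs_mult)
  also have "\<dots> \<le> B * (exp D * \<bar>u\<bar>)"
    using exp_minus_one_two_sided(1)[OF W_log_ratio_bound[OF assms, of m n]] W_bounds[OF assms(2) x] W_pos[OF x] B_ge_1
    unfolding u_def[symmetric] by (intro mult_mono) auto
  also have "\<bar>u\<bar> \<le> (\<Sum>l\<in>{1..N}. \<bar>ln (sweep m i l (x l)) - ln (sweep n j l (x l))\<bar>)"
    unfolding u_def by (rule sum_abs)
  finally show ?thesis using B_ge_1 by (simp add: mult.assoc mult_left_mono)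
qed

subsection \<open>Linear convergence of the dual energy\<close>

text \<open>The dual functional up to an additive constant, as the mass term equals 1 from the first
  completed sweep on.\<close>

definition energy :: "nat \<Rightarrow> real" where
  "energy n = (\<Sum>i\<in>{1..N}. \<integral>x. ln (potential n i x) \<partial>M i)"

definition square_increment :: "nat \<Rightarrow> real" where
  "square_increment n = (\<Sum>i\<in>{1..N}. \<integral>x. (increment n i x)\<^sup>2 \<partial>M i)"

definition convexity_const :: real ("\<alpha>") where "\<alpha> = exp (- D) / 2"

lemma alpha_pos: "\<alpha> > 0" by (simp add: convexity_const_def)

lemma energy_Suc:
  "energy (Suc n) - energy n = (\<Sum>i\<in>{1..N}. \<integral>x. increment n i x \<partial>M i)"
  unfolding energy_def increment_def sum_subtractf[symmetric]
  by (intro sum.cong refl Bochner_Integration.integral_diff[symmetric] integrable_M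
      harnack_bounded_measurable(2) harnack_potential) auto

text \<open>The mean of \<open>exp (- increment n j x)\<close> is the mass before the update, hence
  1. The mean increment therefore equals the mean of exp(-u) - 1 + u, which is at least \<alpha>
  times the mean square. For \<open>n = 0\<close> the mass before the first update would spoil
  this.\<close>

lemma energy_ascent:
  assumes n: "n \<ge> 1"
  shows "\<alpha> * square_increment n \<le> energy (Suc n) - energy n"
proof -
  have "\<alpha> * (\<integral>x. (increment n j x)\<^sup>2 \<partial>M j) \<le> (\<integral>x. increment n j x \<partial>M j)" if j: "j \<in> {1..N}" for j
  proof -
    note b = bounded_measurable_increment[OF j, of n]
    have "(\<integral>x. exp (- increment n j x) \<partial>M j) = (\<integral>x. marginal j (W n (j - 1)) x \<partial>M j)"
      by (intro Bochner_Integration.integral_cong refl marginal_W_before[OF j, symmetric])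
    also have "\<dots> = (\<integral>x. W n (j - 1) x \<partial>R)"
      by (rule integral_marginal[OF j bounded_measurable_W])
    also have "\<dots> = 1" using j n by (intro integral_W) auto
    finally have 1: "(\<integral>x. exp (- increment n j x) \<partial>M j) = 1" .
    have "(\<integral>x. \<alpha> * (increment n j x)\<^sup>2 \<partial>M j) \<le> (\<integral>x. exp (- increment n j x) - 1 + increment n j x \<partial>M j)"
    proof (intro integral_mono integrable_M bounded_measurable_intros b)
      fix x assume "x \<in> space (M j)"
      from exp_quadratic_lower[of "- increment n j x" D] increment_bound[OF j this]
      show "\<alpha> * (increment n j x)\<^sup>2 \<le> exp (- increment n j x) - 1 + increment n j x"
        by (simp add: convexity_const_def)
    qed
    also have "\<dots> = (\<integral>x. exp (- increment n j x) - 1 \<partial>M j) + (\<integral>x. increment n j x \<partial>M j)"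
      by (intro Bochner_Integration.integral_add integrable_M bounded_measurable_intros b)
    also have "(\<integral>x. exp (- increment n j x) - 1 \<partial>M j) = (\<integral>x. exp (- increment n j x) \<partial>M j) - (\<integral>x. 1 \<partial>M j)"
      by (intro Bochner_Integration.integral_diff integrable_M bounded_measurable_intros b)
    finally show ?thesis unfolding 1 integral_const_prob by simp
  qed
  thus ?thesis unfolding energy_Suc square_increment_def sum_distrib_left by (rule sum_mono)
qed

lemma sum_abs_squared_le:
  "(\<Sum>l\<in>{1..N}. \<bar>u l\<bar>)\<^sup>2 \<le> real N * (\<Sum>l\<in>{1..N}. (u l :: real)\<^sup>2)"
  using sum_squared_le_sum_of_squares[of "\<lambda>l. \<bar>u l\<bar>" "{1..N}"] by (simp add: mult.commute)

text \<open>The square of \<open>B * exp D\<close> is the Lipschitz constant from potentials to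
  densities, squared. One factor \<open>N\<close> comes from Cauchy-Schwarz over the increments, the
  other from adding up \<open>N\<close> partial gradients, and \<open>4 * (\<alpha> / B)\<close>
  from Young's inequality.\<close>

definition gap_const :: real where
  "gap_const = real N * ((B * exp D)\<^sup>2 * real N / (4 * (\<alpha> / B)))"

text \<open>Strong concavity of the dual functional. The \<open>i\<close>-th partial gradient at the end of sweep
  \<open>n + 1\<close> differs from its value zero after the \<open>i\<close>-th update only through the increments made in
  that sweep.\<close>

lemma energy_gap:
  assumes m: "m \<ge> 1"
  shows "energy m - energy (Suc n) \<le> gap_const * square_increment n"
proof -
  \<comment> \<open>Modulus of strong concavity: the curvature \<alpha> of the exponential times the
    lower bound \<open>1 / B\<close> of the density.\<close>
  define \<beta> where "\<beta> = \<alpha> / B"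
  have \<beta>: "\<beta> > 0" using alpha_pos B_ge_1 by (simp add: \<beta>_def)
  define \<psi> where "\<psi> i x = ln (potential m i x) - ln (potential (Suc n) i x)" for i x
  define mean where "mean i = (\<integral>x. \<psi> i x \<partial>M i)" for i
  define g where "g i x = \<psi> i x - mean i" for i x
  define \<Delta> where "\<Delta> = energy m - energy (Suc n)"
  define \<Psi> where "\<Psi> x = (\<Sum>i\<in>{1..N}. \<psi> i (x i))" for x
  have b\<psi>: "bounded_measurable (M i) (\<psi> i)" if "i \<in> {1..N}" for i
    unfolding \<psi>_def by (intro bounded_measurable_diff harnack_bounded_measurable(2) harnack_potential that)
  have bg: "bounded_measurable (M i) (g i)" if "i \<in> {1..N}" for i
    unfolding g_def by (intro bounded_measurable_diff b\<psi> that bounded_measurable_const)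
  have bgR: "bounded_measurable R (\<lambda>x. g i (x i))" if "i \<in> {1..N}" for i
    by (rule bounded_measurable_component[OF that bg[OF that]])
  have bdR: "bounded_measurable R (\<lambda>x. increment n i (x i))" if "i \<in> {1..N}" for i
    by (rule bounded_measurable_component[OF that bounded_measurable_increment[OF that]])
  have b\<Psi>: "bounded_measurable R \<Psi>"
    unfolding \<Psi>_def by (intro bounded_measurable_sum bounded_measurable_component b\<psi>)
  have \<Delta>: "\<Delta> = (\<Sum>i\<in>{1..N}. mean i)"
    unfolding \<Delta>_def energy_def mean_def \<psi>_def sum_subtractf[symmetric]
    by (intro sum.cong refl Bochner_Integration.integral_diff[symmetric] integrable_M
        harnack_bounded_measurable(2) harnack_potential) auto
  have \<Psi>: "\<Psi> x = (\<Sum>i\<in>{1..N}. g i (x i)) + \<Delta>" for x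
    unfolding \<Psi>_def g_def \<Delta> by (simp add: sum_subtractf)
  have g0: "(\<integral>x. g i x \<partial>M i) = 0" if "i \<in> {1..N}" for i
  proof -
    have "(\<integral>x. g i x \<partial>M i) = (\<integral>x. \<psi> i x \<partial>M i) - (\<integral>x. mean i \<partial>M i)"
      unfolding g_def by (intro Bochner_Integration.integral_diff integrable_M b\<psi> that bounded_measurable_const)
    thus ?thesis unfolding integral_const_prob mean_def by simp
  qed
  have logs: "(\<Sum>l\<in>{1..N}. ln (sweep m 0 l (x l)) - ln (sweep n N l (x l))) = \<Psi> x" for x
    unfolding \<Psi>_def \<psi>_def by (intro sum.cong) (auto simp: sweep_def)
  \<comment> \<open>Second-order expansion around the end of the sweep: the two densities differ by
    the factor exp(\<Psi>), and \<Psi> stays within the range where the quadratic bound for exp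
    holds.\<close>
  have point: "W n N x * \<Psi> x + \<beta> * (\<Psi> x)\<^sup>2 \<le> W m 0 x - W n N x" if x: "x \<in> space R" for x
  proof -
    have "\<bar>\<Psi> x\<bar> \<le> D" using W_log_ratio_bound[OF _ _ x, of 0 N m n] unfolding logs by simp
    from exp_quadratic_lower[OF this] have e: "\<alpha> * (\<Psi> x)\<^sup>2 \<le> exp (\<Psi> x) - 1 - \<Psi> x"
      by (simp add: convexity_const_def)
    have "\<beta> * (\<Psi> x)\<^sup>2 = (1 / B) * (\<alpha> * (\<Psi> x)\<^sup>2)" by (simp add: \<beta>_def)
    also have "\<dots> \<le> W n N x * (\<alpha> * (\<Psi> x)\<^sup>2)"
      using W_bounds(2)[OF order_refl x] alpha_pos by (intro mult_right_mono) auto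
    also have "\<dots> \<le> W n N x * (exp (\<Psi> x) - 1 - \<Psi> x)"
      using e W_pos[OF x, of n N] by (intro mult_left_mono) auto
    finally show ?thesis
      unfolding W_ratio[OF x, of m 0 n N] logs by (simp add: algebra_simps)
  qed
  have "(\<integral>x. W n N x * \<Psi> x + \<beta> * (\<Psi> x)\<^sup>2 \<partial>R) \<le> (\<integral>x. W m 0 x - W n N x \<partial>R)"
    using point
    by (intro integral_mono integrable_R bounded_measurable_intros b\<Psi> bounded_measurable_W)
  also have "\<dots> = (\<integral>x. W m 0 x \<partial>R) - (\<integral>x. W n N x \<partial>R)"
    by (intro Bochner_Integration.integral_diff integrable_R bounded_measurable_W)
  \<comment> \<open>Both stages have mass 1; for the left one this uses
    \<open>m \<ge> 1\<close>.\<close>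
  also have "\<dots> = 0" using integral_W[of 0 m] integral_W[of N n] m N by simp
  also have "(\<integral>x. W n N x * \<Psi> x + \<beta> * (\<Psi> x)\<^sup>2 \<partial>R) =
      (\<integral>x. W n N x * \<Psi> x \<partial>R) + (\<integral>x. \<beta> * (\<Psi> x)\<^sup>2 \<partial>R)"
    by (intro Bochner_Integration.integral_add integrable_R bounded_measurable_intros b\<Psi> bounded_measurable_W)
  finally have conc: "(\<integral>x. W n N x * \<Psi> x \<partial>R) + \<beta> * (\<integral>x. (\<Psi> x)\<^sup>2 \<partial>R) \<le> 0" by simp
  have "(\<integral>x. W n N x * \<Psi> x \<partial>R) = (\<integral>x. (\<Sum>i\<in>{1..N}. g i (x i) * W n N x) + W n N x * \<Delta> \<partial>R)"
    unfolding \<Psi> by (intro Bochner_Integration.integral_cong refl) (simp add: algebra_simps sum_distrib_right)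
  also have "\<dots> = (\<integral>x. (\<Sum>i\<in>{1..N}. g i (x i) * W n N x) \<partial>R) + (\<integral>x. W n N x * \<Delta> \<partial>R)"
    by (intro Bochner_Integration.integral_add integrable_R bounded_measurable_sum
        bounded_measurable_mult bounded_measurable_const bgR bounded_measurable_W)
  also have "(\<integral>x. W n N x * \<Delta> \<partial>R) = \<Delta>" using integral_W[of N n] N by simp
  also have "(\<integral>x. (\<Sum>i\<in>{1..N}. g i (x i) * W n N x) \<partial>R) = (\<Sum>i\<in>{1..N}. \<integral>x. g i (x i) * W n N x \<partial>R)"
    by (rule Bochner_Integration.integral_sum, intro integrable_R bounded_measurable_mult bgR bounded_measurable_W)
  finally have split: "(\<integral>x. W n N x * \<Psi> x \<partial>R) = (\<Sum>i\<in>{1..N}. \<integral>x. g i (x i) * W n N x \<partial>R) + \<Delta>" .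
  define A where "A = B * exp D"
  \<comment> \<open>Testing \<open>W n i\<close> against the centred \<open>g i\<close> gives zero
    because its \<open>i\<close>-th marginal is 1. Only the change from \<open>W n i\<close> to
    \<open>W n N\<close> remains, and it is due to the coordinates updated after
    \<open>i\<close>.\<close>
  have grad: "- (\<integral>x. g i (x i) * W n N x \<partial>R) \<le>
      A\<^sup>2 * real N / (4 * \<beta>) * square_increment n + \<beta> * (\<integral>x. (g i x)\<^sup>2 \<partial>M i)" if i: "i \<in> {1..N}" for i
  proof -
    have iN: "i \<le> N" using i by simp
    have "(\<integral>x. g i (x i) * W n i x \<partial>R) = (\<integral>x. g i x * marginal i (W n i) x \<partial>M i)"
      by (rule integral_mult_component[OF i bounded_measurable_W bg[OF i]])
    also have "\<dots> = (\<integral>x. g i x \<partial>M i)"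
      by (intro Bochner_Integration.integral_cong refl) (simp add: marginal_W_after[OF i])
    finally have z: "(\<integral>x. g i (x i) * W n i x \<partial>R) = 0" using g0[OF i] by simp
    have "- (\<integral>x. g i (x i) * W n N x \<partial>R) = (\<integral>x. g i (x i) * W n i x \<partial>R) - (\<integral>x. g i (x i) * W n N x \<partial>R)"
      using z by simp
    also have "\<dots> = (\<integral>x. g i (x i) * W n i x - g i (x i) * W n N x \<partial>R)"
      by (intro Bochner_Integration.integral_diff[symmetric] integrable_R bounded_measurable_mult bgR
          bounded_measurable_W i)
    also have "\<dots> \<le> (\<integral>x. A\<^sup>2 * real N / (4 * \<beta>) * (\<Sum>l\<in>{1..N}. (increment n l (x l))\<^sup>2) + \<beta> * (g i (x i))\<^sup>2 \<partial>R)"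
    proof (intro integral_mono integrable_R bounded_measurable_mult bounded_measurable_diff
        bounded_measurable_add bounded_measurable_const bounded_measurable_sum bounded_measurable_power
        bgR bdR bounded_measurable_W i)
      fix x assume x: "x \<in> space R"
      define w where "w = W n i x - W n N x"
      have "\<bar>w\<bar> \<le> A * (\<Sum>l\<in>{1..N}. \<bar>ln (sweep n i l (x l)) - ln (sweep n N l (x l))\<bar>)"
        unfolding w_def A_def by (rule W_difference_bound[OF iN order_refl x])
      also have "\<dots> \<le> A * (\<Sum>l\<in>{1..N}. \<bar>increment n l (x l)\<bar>)"
        using B_ge_1 unfolding A_def
        by (intro mult_left_mono sum_mono) (auto simp: sweep_def increment_def)
      finally have "\<bar>w\<bar>\<^sup>2 \<le> (A * (\<Sum>l\<in>{1..N}. \<bar>increment n l (x l)\<bar>))\<^sup>2" by (rule power_mono) simp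
      also have "\<dots> \<le> A\<^sup>2 * (real N * (\<Sum>l\<in>{1..N}. (increment n l (x l))\<^sup>2))"
        unfolding power_mult_distrib by (intro mult_left_mono sum_abs_squared_le) simp
      finally have w: "w\<^sup>2 \<le> A\<^sup>2 * real N * (\<Sum>l\<in>{1..N}. (increment n l (x l))\<^sup>2)" by (simp add: mult.assoc)
      \<comment> \<open>Young's inequality, weighted so that the quadratic term in
        \<open>g i\<close> has exactly the coefficient \<beta> that concavity can absorb.\<close>
      have "0 \<le> (w - 2 * \<beta> * g i (x i))\<^sup>2" by simp
      hence "4 * \<beta> * (g i (x i) * w) \<le> w\<^sup>2 + 4 * \<beta> * (\<beta> * (g i (x i))\<^sup>2)"
        by (simp add: power2_eq_square algebra_simps)
      hence "4 * \<beta> * (g i (x i) * w) \<le>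
          A\<^sup>2 * real N * (\<Sum>l\<in>{1..N}. (increment n l (x l))\<^sup>2) + 4 * \<beta> * (\<beta> * (g i (x i))\<^sup>2)"
        using w by linarith
      hence "g i (x i) * w \<le> (A\<^sup>2 * real N * (\<Sum>l\<in>{1..N}. (increment n l (x l))\<^sup>2)) / (4 * \<beta>) + \<beta> * (g i (x i))\<^sup>2"
        using \<beta> by (simp add: field_simps)
      thus "g i (x i) * W n i x - g i (x i) * W n N x \<le>
          A\<^sup>2 * real N / (4 * \<beta>) * (\<Sum>l\<in>{1..N}. (increment n l (x l))\<^sup>2) + \<beta> * (g i (x i))\<^sup>2"
        by (simp add: w_def right_diff_distrib)
    qed
    also have "\<dots> = (\<integral>x. A\<^sup>2 * real N / (4 * \<beta>) * (\<Sum>l\<in>{1..N}. (increment n l (x l))\<^sup>2) \<partial>R) +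
        (\<integral>x. \<beta> * (g i (x i))\<^sup>2 \<partial>R)"
      by (intro Bochner_Integration.integral_add integrable_R bounded_measurable_mult
        bounded_measurable_const bounded_measurable_sum bounded_measurable_power bgR bdR i)
    also have "(\<integral>x. \<beta> * (g i (x i))\<^sup>2 \<partial>R) = \<beta> * (\<integral>x. (g i x)\<^sup>2 \<partial>M i)"
      using integral_component[OF i, of "\<lambda>x. (g i x)\<^sup>2"]
        bounded_measurable_measurable[OF bounded_measurable_power[OF bg[OF i], of 2]] by simp
    also have "(\<integral>x. A\<^sup>2 * real N / (4 * \<beta>) * (\<Sum>l\<in>{1..N}. (increment n l (x l))\<^sup>2) \<partial>R) =
        A\<^sup>2 * real N / (4 * \<beta>) * (\<integral>x. (\<Sum>l\<in>{1..N}. (increment n l (x l))\<^sup>2) \<partial>R)" by simp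
    also have "(\<integral>x. (\<Sum>l\<in>{1..N}. (increment n l (x l))\<^sup>2) \<partial>R) = (\<Sum>l\<in>{1..N}. \<integral>x. (increment n l (x l))\<^sup>2 \<partial>R)"
      by (rule Bochner_Integration.integral_sum, intro integrable_R bounded_measurable_power bdR)
    also have "\<dots> = square_increment n"
      unfolding square_increment_def
      by (rule sum.cong[OF refl], rule integral_component, assumption,
          rule bounded_measurable_measurable, intro bounded_measurable_power bounded_measurable_increment)
    finally show ?thesis .
  qed
  have "\<Delta> \<le> (\<Sum>i\<in>{1..N}. - (\<integral>x. g i (x i) * W n N x \<partial>R)) - \<beta> * (\<integral>x. (\<Psi> x)\<^sup>2 \<partial>R)"
    using conc unfolding split sum_negf by linarith
  also have "(\<Sum>i\<in>{1..N}. - (\<integral>x. g i (x i) * W n N x \<partial>R)) \<le>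
      (\<Sum>i\<in>{1..N}. A\<^sup>2 * real N / (4 * \<beta>) * square_increment n + \<beta> * (\<integral>x. (g i x)\<^sup>2 \<partial>M i))"
    by (intro sum_mono grad)
  also have "\<dots> = gap_const * square_increment n + \<beta> * (\<Sum>i\<in>{1..N}. \<integral>x. (g i x)\<^sup>2 \<partial>M i)"
    by (simp add: sum.distrib sum_distrib_left gap_const_def A_def \<beta>_def)
  \<comment> \<open>Orthogonality lets the concavity term swallow all the squares of the
    \<open>g i\<close>, although it sees only their sum shifted by \<Delta>.\<close>
  also have "\<beta> * (\<Sum>i\<in>{1..N}. \<integral>x. (g i x)\<^sup>2 \<partial>M i) \<le> \<beta> * (\<integral>x. (\<Psi> x)\<^sup>2 \<partial>R)"
    unfolding \<Psi> using \<beta> by (intro mult_left_mono sum_centered_squares bg g0) auto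
  finally show ?thesis by (simp add: \<Delta>_def)
qed

lemma square_increment_nonneg: "0 \<le> square_increment n"
  unfolding square_increment_def by (intro sum_nonneg integral_nonneg) auto

text \<open>The ascent is used twice: to bound the remaining gap by the gain of the last sweep with
  constant \<open>gap_const / \<alpha>\<close>, and to turn the resulting decay of the gains back
  into decay of the squared increments.\<close>

lemma square_increment_geometric:
  obtains A q where "A \<ge> 0" "0 < q" "q < 1" "\<And>n. n \<ge> 1 \<Longrightarrow> square_increment n \<le> A * q ^ n"
proof -
  have gap_pos: "gap_const > 0" using N B_ge_1 alpha_pos unfolding gap_const_def by simp
  obtain A q where q: "A \<ge> 0" "0 < q" "q < 1" and
    Aq: "\<And>n. n \<ge> 1 \<Longrightarrow> energy (Suc n) - energy n \<le> A * q ^ n"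
  proof (rule geometric_increments[of energy "gap_const / \<alpha>"])
    fix n :: nat assume n: "n \<ge> 1"
    have "0 \<le> \<alpha> * square_increment n" using alpha_pos square_increment_nonneg by simp
    thus "energy n \<le> energy (Suc n)" using energy_ascent[OF n] by linarith
    fix m :: nat assume m: "m \<ge> 1"
    have "energy m - energy (Suc n) \<le> gap_const * square_increment n" by (rule energy_gap[OF m])
    also have "\<dots> = gap_const / \<alpha> * (\<alpha> * square_increment n)" using alpha_pos by simp
    also have "\<dots> \<le> gap_const / \<alpha> * (energy (Suc n) - energy n)"
      using energy_ascent[OF n] gap_pos alpha_pos by (intro mult_left_mono) auto
    finally show "energy m - energy (Suc n) \<le> gap_const / \<alpha> * (energy (Suc n) - energy n)" .
  qed (use gap_pos alpha_pos in auto)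
  show ?thesis
  proof (rule that[of "A / \<alpha>" q])
    fix n :: nat assume n: "n \<ge> 1"
    have "\<alpha> * square_increment n \<le> A * q ^ n" using energy_ascent[OF n] Aq[OF n] by linarith
    thus "square_increment n \<le> A / \<alpha> * q ^ n" using alpha_pos by (simp add: field_simps)
  qed (use q alpha_pos in auto)
qed

subsection \<open>Uniform convergence of the potentials\<close>

definition abs_increment :: "nat \<Rightarrow> real" where
  "abs_increment n = (\<Sum>i\<in>{1..N}. \<integral>x. \<bar>increment n i x\<bar> \<partial>M i)"

lemma abs_increment_le: "abs_increment n \<le> real N * sqrt (square_increment n)"
proof -
  have "(\<integral>x. \<bar>increment n i x\<bar> \<partial>M i) \<le> sqrt (square_increment n)" if i: "i \<in> {1..N}" for i
  proof (rule real_le_rsqrt)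
    have "(\<integral>x. \<bar>increment n i x\<bar> \<partial>M i)\<^sup>2 \<le> (\<integral>x. \<bar>increment n i x\<bar>\<^sup>2 \<partial>M i)"
      by (intro prob_space.square_expectation_le[OF prob_space_M] bounded_measurable_abs
          bounded_measurable_increment i)
    also have "\<dots> \<le> square_increment n"
      unfolding square_increment_def power2_abs
      by (rule member_le_sum[OF i, where f = "\<lambda>i. \<integral>x. (increment n i x)\<^sup>2 \<partial>M i"]) auto
    finally show "(\<integral>x. \<bar>increment n i x\<bar> \<partial>M i)\<^sup>2 \<le> square_increment n" .
  qed
  hence "abs_increment n \<le> (\<Sum>i\<in>{1..N}. sqrt (square_increment n))"
    unfolding abs_increment_def by (rule sum_mono)
  thus ?thesis by simp
qed

text \<open>Between two consecutive updates of coordinate \<open>j\<close> every other coordinate is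
  updated exactly once. The \<open>j\<close>-th marginal is 1 at the start of that window and
  \<open>exp (- increment (Suc n) j x)\<close> at its end, so the increment at the single point
  \<open>x\<close> is controlled by integrals of the other increments.\<close>

lemma increment_uniform_bound:
  assumes j: "j \<in> {1..N}" and x: "x \<in> space (M j)"
  shows "\<bar>increment (Suc n) j x\<bar> \<le> exp D * (B * exp D) * (abs_increment (Suc n) + abs_increment n)"
proof -
  let ?h = "\<lambda>y. \<Sum>l\<in>{1..N} - {j}. \<bar>increment (Suc n) l (y l)\<bar> + \<bar>increment n l (y l)\<bar>"
  have bd: "bounded_measurable (R_without j) (\<lambda>y. increment k l (y l))" if "l \<in> {1..N} - {j}" for k l
    using that by (intro bounded_measurable_component bounded_measurable_increment) auto
  note b = bounded_measurable_abs[OF bd]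
  have jN: "j - 1 \<le> N" "j \<le> N" using j by auto
  have bW: "bounded_measurable (R_without j) (\<lambda>y. W k l (y(j := x)))" for k l
    by (rule bounded_measurable_update[OF j x bounded_measurable_W])
  have "exp (- increment (Suc n) j x) - 1 = marginal j (W (Suc n) (j - 1)) x - marginal j (W n j) x"
    by (simp only: marginal_W_before[OF j x] marginal_W_after[OF j x])
  also have "\<dots> = (\<integral>y. W (Suc n) (j - 1) (y(j := x)) - W n j (y(j := x)) \<partial>R_without j)"
    unfolding marginal_def
    by (intro Bochner_Integration.integral_diff[symmetric] integrable_R_without bW)
  finally have "\<bar>exp (- increment (Suc n) j x) - 1\<bar> \<le>
      (\<integral>y. \<bar>W (Suc n) (j - 1) (y(j := x)) - W n j (y(j := x))\<bar> \<partial>R_without j)"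
    by (simp only: integral_abs_bound)
  also have "\<dots> \<le> (\<integral>y. B * exp D * ?h y \<partial>R_without j)"
  proof (intro integral_mono integrable_R_without bounded_measurable_abs bounded_measurable_diff bW
      bounded_measurable_mult bounded_measurable_const bounded_measurable_sum bounded_measurable_add bd)
    fix y assume y: "y \<in> space (R_without j)"
    let ?z = "y(j := x)"
    have W: "\<bar>W (Suc n) (j - 1) ?z - W n j ?z\<bar> \<le>
        B * exp D * (\<Sum>l\<in>{1..N}. \<bar>ln (sweep (Suc n) (j - 1) l (?z l)) - ln (sweep n j l (?z l))\<bar>)"
      by (rule W_difference_bound[OF jN update_space[OF j x y]])
    \<comment> \<open>Coordinate \<open>j\<close> holds the same potential at both ends of the
      window, so its term vanishes.\<close>
    have "(\<Sum>l\<in>{1..N}. \<bar>ln (sweep (Suc n) (j - 1) l (?z l)) - ln (sweep n j l (?z l))\<bar>) =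
        (\<Sum>l\<in>{1..N} - {j}. \<bar>ln (sweep (Suc n) (j - 1) l (?z l)) - ln (sweep n j l (?z l))\<bar>)"
      using j by (subst sum.remove[of _ j]) (auto simp: sweep_def)
    also have "\<dots> \<le> ?h y"
    proof (rule sum_mono)
      \<comment> \<open>For \<open>l < j\<close> the change in the window is the increment of sweep
        index \<open>Suc n\<close>, for \<open>l > j\<close> that of index \<open>n\<close>; the sum
        of both covers either case.\<close>
      fix l assume "l \<in> {1..N} - {j}"
      hence "l \<noteq> j" by simp
      thus "\<bar>ln (sweep (Suc n) (j - 1) l (?z l)) - ln (sweep n j l (?z l))\<bar> \<le>
          \<bar>increment (Suc n) l (y l)\<bar> + \<bar>increment n l (y l)\<bar>"
        by (cases "l < j") (auto simp: sweep_def increment_def)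
    qed
    finally have "B * exp D * (\<Sum>l\<in>{1..N}. \<bar>ln (sweep (Suc n) (j - 1) l (?z l)) - ln (sweep n j l (?z l))\<bar>)
        \<le> B * exp D * ?h y"
      by (rule mult_left_mono) (use B_ge_1 in simp)
    with W show "\<bar>W (Suc n) (j - 1) ?z - W n j ?z\<bar> \<le> B * exp D * ?h y" by (rule order_trans)
  qed
  also have "\<dots> = B * exp D * (\<integral>y. ?h y \<partial>R_without j)" by (rule integral_mult_right_zero)
  finally have eh: "\<bar>exp (- increment (Suc n) j x) - 1\<bar> \<le> B * exp D * (\<integral>y. ?h y \<partial>R_without j)" .
  have "(\<integral>y. ?h y \<partial>R_without j) =
      (\<Sum>l\<in>{1..N} - {j}. \<integral>y. \<bar>increment (Suc n) l (y l)\<bar> + \<bar>increment n l (y l)\<bar> \<partial>R_without j)"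
    by (rule Bochner_Integration.integral_sum, intro integrable_R_without bounded_measurable_add b)
  also have "\<dots> = (\<Sum>l\<in>{1..N} - {j}. (\<integral>x. \<bar>increment (Suc n) l x\<bar> \<partial>M l) + (\<integral>x. \<bar>increment n l x\<bar> \<partial>M l))"
  proof (rule sum.cong[OF refl])
    fix l assume l: "l \<in> {1..N} - {j}"
    have *: "(\<integral>y. \<bar>increment k l (y l)\<bar> \<partial>R_without j) = (\<integral>x. \<bar>increment k l x\<bar> \<partial>M l)" for k
      using l by (intro integral_component[OF l] bounded_measurable_measurable bounded_measurable_abs
          bounded_measurable_increment) auto
    show "(\<integral>y. \<bar>increment (Suc n) l (y l)\<bar> + \<bar>increment n l (y l)\<bar> \<partial>R_without j) =
        (\<integral>x. \<bar>increment (Suc n) l x\<bar> \<partial>M l) + (\<integral>x. \<bar>increment n l x\<bar> \<partial>M l)"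
      unfolding *[symmetric] by (intro Bochner_Integration.integral_add integrable_R_without b l)
  qed
  also have "\<dots> \<le> (\<Sum>l\<in>{1..N}. (\<integral>x. \<bar>increment (Suc n) l x\<bar> \<partial>M l) + (\<integral>x. \<bar>increment n l x\<bar> \<partial>M l))"
    by (intro sum_mono2) auto
  also have "\<dots> = abs_increment (Suc n) + abs_increment n"
    by (simp add: abs_increment_def sum.distrib)
  finally have "B * exp D * (\<integral>y. ?h y \<partial>R_without j) \<le> B * exp D * (abs_increment (Suc n) + abs_increment n)"
    by (rule mult_left_mono) (use B_ge_1 in simp)
  with eh have e: "\<bar>exp (- increment (Suc n) j x) - 1\<bar> \<le> B * exp D * (abs_increment (Suc n) + abs_increment n)"
    by (rule order_trans)
  have "\<bar>increment (Suc n) j x\<bar> \<le> exp D * \<bar>exp (- increment (Suc n) j x) - 1\<bar>"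
    using exp_minus_one_two_sided(2)[of "- increment (Suc n) j x" D] increment_bound[OF j x] by simp
  also have "\<dots> \<le> exp D * (B * exp D * (abs_increment (Suc n) + abs_increment n))"
    by (rule mult_left_mono[OF e]) simp
  finally show ?thesis by (simp add: mult_ac)
qed

lemma increment_geometric:
  "\<exists>C r. 0 < r \<and> r < 1 \<and> (\<forall>n. \<forall>i\<in>{1..N}. \<forall>x\<in>space (M i). \<bar>increment n i x\<bar> \<le> C * r ^ n)"
proof -
  obtain A q where q: "A \<ge> 0" "0 < q" "q < 1"
    and sq: "\<And>n. n \<ge> 1 \<Longrightarrow> square_increment n \<le> A * q ^ n"
    using square_increment_geometric by blast
  \<comment> \<open>The squares decay like \<open>q ^ n\<close>, so the increments themselves decay
    at the root of that rate.\<close>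
  define r where "r = sqrt q"
  have r: "0 < r" "r < 1" using q by (auto simp: r_def)
  have ab: "abs_increment n \<le> real N * sqrt A * r ^ n" if "n \<ge> 1" for n
  proof -
    have "sqrt (square_increment n) \<le> sqrt (A * q ^ n)" using sq[OF that] by simp
    also have "\<dots> = sqrt A * r ^ n" by (simp add: r_def real_sqrt_mult real_sqrt_power)
    finally have "real N * sqrt (square_increment n) \<le> real N * (sqrt A * r ^ n)"
      by (rule mult_left_mono) simp
    thus ?thesis using abs_increment_le[of n] by (simp add: mult.assoc)
  qed
  define E where "E = exp D * (B * exp D)"
  define F where "F = E * (2 * (real N * sqrt A)) / r"
  have E: "E \<ge> 0" using B_ge_1 by (simp add: E_def)
  have F: "F \<ge> 0" using E q r by (simp add: F_def)
  show ?thesis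
  \<comment> \<open>\<open>F\<close> covers \<open>n \<ge> 2\<close>, its division by
    \<open>r\<close> absorbing the shift from \<open>k\<close> to \<open>n = Suc k\<close>. The term
    \<open>D / r\<close> covers the two initial sweeps by the crude bound \<open>D\<close>.\<close>
  proof (rule exI[of _ "F + D / r"], rule exI[of _ r], intro conjI r allI ballI)
    fix n i x assume i: "i \<in> {1..N}" and x: "x \<in> space (M i)"
    show "\<bar>increment n i x\<bar> \<le> (F + D / r) * r ^ n"
    proof (cases "n \<le> 1")
      case True
      hence "r * 1 \<le> 1 * r ^ n" using r by (cases n) auto
      hence "D / r * r \<le> D / r * r ^ n" using D_nonneg r by (intro mult_left_mono) auto
      moreover have "0 \<le> F * r ^ n" using F r by simp
      moreover have "D / r * r = D" using r by simp
      ultimately show ?thesis using increment_bound[OF i x, of n] unfolding distrib_right by linarith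
    next
      case False
      then obtain k where k: "n = Suc k" "k \<ge> 1" by (cases n) auto
      have N0: "0 \<le> real N * sqrt A" using q by simp
      have "abs_increment (Suc k) \<le> real N * sqrt A * r ^ Suc k" using ab[of "Suc k"] by simp
      also have "\<dots> \<le> real N * sqrt A * r ^ k" using r N0 by (intro mult_left_mono power_decreasing) auto
      finally have "abs_increment (Suc k) + abs_increment k \<le> 2 * (real N * sqrt A) * r ^ k"
        using ab[OF k(2)] by simp
      hence "E * (abs_increment (Suc k) + abs_increment k) \<le> E * (2 * (real N * sqrt A) * r ^ k)"
        using E by (rule mult_left_mono)
      also have "\<dots> = F * r ^ n" using r by (simp add: F_def k)
      finally have "\<bar>increment n i x\<bar> \<le> F * r ^ n"
        using increment_uniform_bound[OF i x, of k] unfolding E_def[symmetric] k(1) by linarith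
      moreover have "0 \<le> D / r * r ^ n" using D_nonneg r by simp
      ultimately show ?thesis unfolding distrib_right by linarith
    qed
  qed
qed

section \<open>The limit potentials and their equations\<close>

definition limit_potential :: "nat \<Rightarrow> 'a \<Rightarrow> real" where
  "limit_potential i x = exp (\<Sum>n. increment n i x)"

text \<open>There is no initial term because the iteration starts from the constant 1.\<close>

lemma ln_potential_telescope: "ln (potential n i x) = (\<Sum>k<n. increment k i x)"
  unfolding increment_def by (subst sum_lessThan_telescope) (simp add: ipfp.simps(1))

lemma potential_tendsto:
  assumes i: "i \<in> {1..N}" and x: "x \<in> space (M i)"
  shows "(\<lambda>n. potential n i x) \<longlonglongrightarrow> limit_potential i x"
proof -
  obtain C r where r: "0 < r" "r < 1"
    and inc: "\<forall>n. \<forall>i\<in>{1..N}. \<forall>x\<in>space (M i). \<bar>increment n i x\<bar> \<le> C * r ^ n"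
    using increment_geometric by blast
  have "summable (\<lambda>n. increment n i x)"
  proof (rule summable_comparison_test'[where g = "\<lambda>n. C * r ^ n" and N = 0])
    show "summable (\<lambda>n. C * r ^ n)" using r by (intro summable_mult summable_geometric) simp
    show "norm (increment n i x) \<le> C * r ^ n" for n using inc[rule_format, OF i x, of n] by simp
  qed
  hence "(\<lambda>n. exp (\<Sum>k<n. increment k i x)) \<longlonglongrightarrow> exp (\<Sum>n. increment n i x)"
    by (intro tendsto_exp summable_LIMSEQ)
  moreover have "exp (\<Sum>k<n. increment k i x) = potential n i x" for n
    unfolding ln_potential_telescope[symmetric] by (simp only: exp_ln[OF potential_pos[OF i x]])
  ultimately show ?thesis by (simp add: limit_potential_def)
qed

lemma potential_bounded:
  "\<exists>P. \<forall>n. \<forall>i\<in>{1..N}. \<forall>x\<in>space (M i). \<bar>potential n i x\<bar> \<le> P"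
proof -
  obtain C r where r: "0 < r" "r < 1"
    and inc: "\<forall>n. \<forall>i\<in>{1..N}. \<forall>x\<in>space (M i). \<bar>increment n i x\<bar> \<le> C * r ^ n"
    using increment_geometric by blast
  obtain x0 where x0: "x0 \<in> space (M 1)" using space_M_nonempty by blast
  \<comment> \<open>Evaluating the geometric bound at index 0 shows that its constant is
    nonnegative, so that the partial sums are at most the full series.\<close>
  have "\<bar>increment 0 1 x0\<bar> \<le> C * r ^ 0" by (intro inc[rule_format] x0) (use N in simp)
  hence C: "C \<ge> 0" by simp
  show ?thesis
  proof (intro exI allI ballI)
    fix n i x assume i: "i \<in> {1..N}" and x: "x \<in> space (M i)"
    have "(\<Sum>k<n. increment k i x) \<le> (\<Sum>k<n. C * r ^ k)"
      by (rule sum_mono, rule abs_le_D1, intro inc[rule_format] i x)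
    also have "\<dots> \<le> (\<Sum>k. C * r ^ k)"
      using r C by (intro sum_le_suminf summable_mult summable_geometric) auto
    finally have "ln (potential n i x) \<le> (\<Sum>k. C * r ^ k)" unfolding ln_potential_telescope .
    hence "exp (ln (potential n i x)) \<le> exp (\<Sum>k. C * r ^ k)" by simp
    thus "\<bar>potential n i x\<bar> \<le> exp (\<Sum>k. C * r ^ k)"
      using potential_pos[OF i x, of n] by simp
  qed
qed

text \<open>The oscillation inequality passes to the limit; strict positivity, which a limit could
  lose, is built into the exponential form.\<close>

lemma harnack_limit_potential:
  assumes i: "i \<in> {1..N}"
  shows "harnack i (limit_potential i)"
  unfolding harnack_def
proof (intro conjI ballI)
  show "limit_potential i \<in> borel_measurable (M i)"
    by (rule borel_measurable_LIMSEQ_real[of "M i" "\<lambda>n. potential n i"])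
       (simp_all only: potential_tendsto[OF i] harnack_measurable[OF harnack_potential[OF i]])
  fix x assume x: "x \<in> space (M i)"
  show "0 < limit_potential i x" by (simp add: limit_potential_def)
  fix y assume y: "y \<in> space (M i)"
  show "limit_potential i x \<le> K\<^sup>2 * limit_potential i y"
  proof (rule LIMSEQ_le[OF potential_tendsto[OF i x] tendsto_mult_left[OF potential_tendsto[OF i y]]])
    show "\<exists>m. \<forall>n\<ge>m. potential n i x \<le> K\<^sup>2 * potential n i y"
      using harnack_potential[OF i] x y unfolding harnack_def by blast
  qed
qed

lemma sweep_tendsto:
  assumes i: "i \<in> {1..N}" and x: "x \<in> space (M i)"
  shows "(\<lambda>n. sweep n j i x) \<longlonglongrightarrow> limit_potential i x"
  using potential_tendsto[OF assms] LIMSEQ_Suc[OF potential_tendsto[OF assms]]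
  by (cases "i \<le> j") (simp_all add: sweep_def)

lemma W_tendsto:
  assumes x: "x \<in> space R"
  shows "(\<lambda>n. W n j x) \<longlonglongrightarrow> gibbs_density limit_potential x"
  unfolding gibbs_density_def
  by (intro tendsto_mult_right tendsto_prod sweep_tendsto component_space[OF x])

text \<open>The diagonal choice matters: for fixed \<open>j\<close> the stages just after update
  \<open>j\<close> have marginal exactly 1, and they converge to the limit density under the common
  bound \<open>B\<close>.\<close>

lemma marginal_limit_density:
  assumes j: "j \<in> {1..N}" and x: "x \<in> space (M j)"
  shows "marginal j (gibbs_density limit_potential) x = 1"
proof -
  have jN: "j \<le> N" using j by simp
  have "(\<lambda>n. marginal j (W n j) x) \<longlonglongrightarrow> marginal j (gibbs_density limit_potential) x"
    unfolding marginal_def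
  proof (rule integral_dominated_convergence[where w = "\<lambda>_. B"])
    show "AE y in R_without j. (\<lambda>n. W n j (y(j := x))) \<longlonglongrightarrow> gibbs_density limit_potential (y(j := x))"
      by (rule AE_I2) (rule W_tendsto[OF update_space[OF j x]])
    fix n
    show "AE y in R_without j. norm (W n j (y(j := x))) \<le> B"
    proof (rule AE_I2)
      fix y assume "y \<in> space (R_without j)"
      from W_bounds(1)[OF jN update_space[OF j x this], of n] W_pos[OF update_space[OF j x this], of n j]
      show "norm (W n j (y(j := x))) \<le> B" by simp
    qed
    show "(\<lambda>y. W n j (y(j := x))) \<in> borel_measurable (R_without j)"
      by (rule bounded_measurable_measurable[OF bounded_measurable_update[OF j x bounded_measurable_W]])
  next
    show "(\<lambda>y. gibbs_density limit_potential (y(j := x))) \<in> borel_measurable (R_without j)"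
      by (intro bounded_measurable_measurable bounded_measurable_update[OF j x]
          bounded_measurable_gibbs_density harnack_limit_potential)
    show "integrable (R_without j) (\<lambda>_. B)"
      by (intro integrable_R_without bounded_measurable_const)
  qed
  thus ?thesis unfolding marginal_W_after[OF j x] by (simp add: LIMSEQ_const_iff)
qed

lemma limit_solves_system: "schrodinger_system N M c \<epsilon> limit_potential"
  unfolding schrodinger_system_def
proof (intro conjI ballI)
  fix i assume i: "i \<in> {1..N}"
  show "limit_potential i \<in> borel_measurable (M i)"
    using harnack_limit_potential[OF i] by (simp add: harnack_def)
  show "0 \<le> limit_potential i x" for x by (simp add: limit_potential_def)
  have "limit_potential i x * partial_mass i limit_potential x = 1" if x: "x \<in> space (M i)" for x
    using marginal_limit_density[OF i x] unfolding marginal_gibbs_density[OF i] .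
  thus "AE x in M i. limit_potential i x *
      (\<integral>y. (\<Prod>j\<in>{1..N} - {i}. limit_potential j (y j)) * gibbs c \<epsilon> (y(i := x)) \<partial>R_without i) = 1"
    unfolding partial_mass_def by (rule AE_I2)
qed

lemma potential_Lp_tendsto:
  assumes i: "i \<in> {1..N}" and p: "p \<ge> 1"
  shows "Lp_tendsto p (M i) (\<lambda>n. potential n i) (limit_potential i)"
proof -
  obtain P where P: "\<forall>n. \<forall>i\<in>{1..N}. \<forall>x\<in>space (M i). \<bar>potential n i x\<bar> \<le> P"
    using potential_bounded by blast
  show ?thesis
  proof (rule prob_space.Lp_tendsto_bounded[OF prob_space_M _ _ _ _ p])
    show "AE x in M i. \<bar>potential n i x\<bar> \<le> P" for n using P i by (intro AE_I2) blast
    show "AE x in M i. (\<lambda>n. potential n i x) \<longlonglongrightarrow> limit_potential i x"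
      by (intro AE_I2 potential_tendsto i)
  qed (intro harnack_measurable harnack_potential harnack_limit_potential i)+
qed

subsection \<open>The optimal coupling\<close>

definition limit_density :: "(nat \<Rightarrow> 'a) \<Rightarrow> real" where
  "limit_density = gibbs_density limit_potential"

definition limit_coupling :: "(nat \<Rightarrow> 'a) measure" where
  "limit_coupling = density R (\<lambda>x. ennreal (limit_density x))"

text \<open>The dual value at the limit, which turns out to be the minimal entropy.\<close>

definition limit_energy :: real where
  "limit_energy = (\<Sum>i\<in>{1..N}. \<integral>x. ln (limit_potential i x) \<partial>M i)"

lemma bounded_measurable_limit_density: "bounded_measurable R limit_density"
  unfolding limit_density_def by (intro bounded_measurable_gibbs_density harnack_limit_potential)

lemma limit_density_pos: "x \<in> space R \<Longrightarrow> 0 < limit_density x"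
  unfolding limit_density_def by (rule gibbs_density_pos[OF harnack_limit_potential])

lemma integral_limit_density: "(\<integral>x. limit_density x \<partial>R) = 1"
proof -
  have 1: "1 \<in> {1..N}" using N by simp
  have "(\<integral>x. limit_density x \<partial>R) = (\<integral>x. marginal 1 limit_density x \<partial>M 1)"
    by (rule integral_marginal[OF 1 bounded_measurable_limit_density, symmetric])
  also have "\<dots> = (\<integral>x. 1 \<partial>M 1)"
    by (intro Bochner_Integration.integral_cong refl) (unfold limit_density_def, rule marginal_limit_density[OF 1])
  finally show ?thesis by (simp only: integral_const_prob)
qed

lemma limit_coupling_in_couplings: "limit_coupling \<in> couplings N M"
proof -
  note m = bounded_measurable_measurable[OF bounded_measurable_limit_density]
  have nn: "(\<integral>\<^sup>+x. ennreal (f x * limit_density x) \<partial>R) = ennreal (\<integral>x. f x * limit_density x \<partial>R)"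
    if "bounded_measurable R f" "\<And>x. 0 \<le> f x" for f
    by (intro nn_integral_eq_integral integrable_R bounded_measurable_mult bounded_measurable_limit_density
        AE_I2 mult_nonneg_nonneg that less_imp_le limit_density_pos)
  have "prob_space limit_coupling"
  proof (rule prob_spaceI)
    have "emeasure limit_coupling (space limit_coupling) =
        (\<integral>\<^sup>+x. ennreal (limit_density x) * indicator (space R) x \<partial>R)"
      unfolding limit_coupling_def space_density by (rule emeasure_density) (use m in auto)
    also have "\<dots> = (\<integral>\<^sup>+x. ennreal (1 * limit_density x) \<partial>R)"
      by (intro nn_integral_cong) simp
    also have "\<dots> = ennreal (\<integral>x. 1 * limit_density x \<partial>R)"
      by (rule nn[OF bounded_measurable_const]) simp
    also have "\<dots> = 1" by (simp only: mult_1 integral_limit_density ennreal_1)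
    finally show "emeasure limit_coupling (space limit_coupling) = 1" .
  qed
  moreover have "distr limit_coupling (M i) (\<lambda>x. x i) = M i" if i: "i \<in> {1..N}" for i
  proof (rule measure_eqI)
    fix A assume "A \<in> sets (distr limit_coupling (M i) (\<lambda>x. x i))"
    hence A: "A \<in> sets (M i)" by simp
    have c: "(\<lambda>x. x i) \<in> measurable R (M i)" by (rule measurable_component_singleton[OF i])
    note bA = bounded_measurable_component[OF i bounded_measurable_indicator[OF A]]
    have "emeasure (distr limit_coupling (M i) (\<lambda>x. x i)) A =
        emeasure (density R (\<lambda>x. ennreal (limit_density x))) ((\<lambda>x. x i) -` A \<inter> space R)"
      using A c by (subst emeasure_distr) (auto simp: limit_coupling_def)
    also have "\<dots> = (\<integral>\<^sup>+x. ennreal (limit_density x) * indicator ((\<lambda>x. x i) -` A \<inter> space R) x \<partial>R)"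
      by (rule emeasure_density) (use m measurable_sets[OF c A] in auto)
    also have "\<dots> = (\<integral>\<^sup>+x. ennreal (indicator A (x i) * limit_density x) \<partial>R)"
      by (intro nn_integral_cong) (auto split: split_indicator)
    also have "\<dots> = ennreal (\<integral>x. indicator A (x i) * limit_density x \<partial>R)"
      by (rule nn[OF bA]) simp
    also have "(\<integral>x. indicator A (x i) * limit_density x \<partial>R) = (\<integral>x. indicator A x * marginal i limit_density x \<partial>M i)"
      by (rule integral_mult_component[OF i bounded_measurable_limit_density bounded_measurable_indicator[OF A]])
    also have "\<dots> = (\<integral>x. indicator A x \<partial>M i)"
      unfolding limit_density_def
      by (intro Bochner_Integration.integral_cong refl) (simp add: marginal_limit_density[OF i])
    also have "\<dots> = measure (M i) A" using A by simp
    also have "ennreal \<dots> = emeasure (M i) A"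
      by (rule finite_measure.emeasure_eq_measure[OF prob_space.finite_measure[OF prob_space_M], symmetric])
    finally show "emeasure (distr limit_coupling (M i) (\<lambda>x. x i)) A = emeasure (M i) A" .
  qed simp
  ultimately show ?thesis by (auto simp: couplings_def limit_coupling_def)
qed

text \<open>On couplings the logarithm of the limit density integrates to a constant plus the kernel part,
  so the entropy relative to the kernel is, up to a constant, the entropy relative to the limit.\<close>

lemma KL_coupling:
  assumes \<gamma>: "\<gamma> \<in> couplings N M" and ac: "absolutely_continuous R \<gamma>"
  shows "KL R (gibbs c \<epsilon>) \<gamma> =
    enn2ereal (\<integral>\<^sup>+x. ennreal (real_density R \<gamma> x * ln (real_density R \<gamma> x / limit_density x)
      - real_density R \<gamma> x + limit_density x) \<partial>R) + ereal limit_energy"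
proof -
  define h where "h = real_density R \<gamma>"
  define S where "S x = (\<Sum>i\<in>{1..N}. ln (limit_potential i (x i)))" for x :: "nat \<Rightarrow> 'a"
  have G: "prob_space \<gamma>" "sets \<gamma> = sets R" and marg: "\<And>i. i \<in> {1..N} \<Longrightarrow> distr \<gamma> (M i) (\<lambda>x. x i) = M i"
    using \<gamma> by (auto simp: couplings_def)
  interpret G: prob_space \<gamma> by fact
  have h0: "h x \<ge> 0" for x by (simp add: h_def real_density_nonneg)
  have hm [measurable]: "h \<in> borel_measurable R" by (simp add: h_def)
  have gm [measurable]: "limit_density \<in> borel_measurable R"
    by (rule bounded_measurable_measurable[OF bounded_measurable_limit_density])
  have dens: "density R (\<lambda>x. ennreal (h x)) = \<gamma>"
    unfolding h_def by (rule density_real_density[OF prob_space_R G(1) ac G(2)])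
  have bl: "bounded_measurable (M i) (\<lambda>x. ln (limit_potential i x))" if "i \<in> {1..N}" for i
    by (intro harnack_bounded_measurable harnack_limit_potential that)
  have bS: "bounded_measurable R S"
    unfolding S_def by (intro bounded_measurable_sum bounded_measurable_component[where f = "\<lambda>x. ln (limit_potential _ x)"] bl)
  have bm: "bounded_measurable \<gamma> f" if "bounded_measurable R f" for f
    using that sets_eq_imp_space_eq[OF G(2)] measurable_cong_sets[OF G(2) refl]
    by (auto simp: bounded_measurable_def)
  \<comment> \<open>Bounded functions are integrable against the probability measure \<gamma>, so
    their products with \<open>h\<close> are integrable although \<open>h\<close> may be
    unbounded.\<close>
  have int: "integrable R (\<lambda>x. h x * f x)" "(\<integral>x. h x * f x \<partial>R) = (\<integral>x. f x \<partial>\<gamma>)"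
    if f: "bounded_measurable R f" for f
  proof -
    have fm: "f \<in> borel_measurable R" using f by (rule bounded_measurable_measurable)
    have "integrable (density R (\<lambda>x. ennreal (h x))) f"
      unfolding dens by (rule G.integrable_bounded_measurable[OF bm[OF f]])
    thus "integrable R (\<lambda>x. h x * f x)"
      by (subst (asm) integrable_density) (use fm hm h0 in auto)
    have "(\<integral>x. f x \<partial>density R (\<lambda>x. ennreal (h x))) = (\<integral>x. h x *\<^sub>R f x \<partial>R)"
      by (rule integral_density) (use fm hm h0 in auto)
    thus "(\<integral>x. h x * f x \<partial>R) = (\<integral>x. f x \<partial>\<gamma>)" unfolding dens by simp
  qed
  have ih: "integrable R h" "(\<integral>x. h x \<partial>R) = 1"
    using int[OF bounded_measurable_const[of _ 1]] by (simp_all add: G.prob_space)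
  have "(\<integral>x. S x \<partial>\<gamma>) = (\<Sum>i\<in>{1..N}. \<integral>x. ln (limit_potential i (x i)) \<partial>\<gamma>)"
    unfolding S_def
    by (rule Bochner_Integration.integral_sum, rule G.integrable_bounded_measurable, rule bm,
        rule bounded_measurable_component[where f = "\<lambda>x. ln (limit_potential _ x)"], assumption, rule bl)
  also have "\<dots> = limit_energy"
    unfolding limit_energy_def
  proof (rule sum.cong[OF refl])
    fix i assume i: "i \<in> {1..N}"
    have "(\<lambda>x. x i) \<in> measurable \<gamma> (M i)"
      unfolding measurable_cong_sets[OF G(2) refl] by (rule measurable_component_singleton[OF i])
    hence "(\<integral>x. ln (limit_potential i x) \<partial>distr \<gamma> (M i) (\<lambda>x. x i)) = (\<integral>x. ln (limit_potential i (x i)) \<partial>\<gamma>)"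
      by (rule integral_distr) (rule bounded_measurable_measurable[OF bl[OF i]])
    thus "(\<integral>x. ln (limit_potential i (x i)) \<partial>\<gamma>) = (\<integral>x. ln (limit_potential i x) \<partial>M i)"
      unfolding marg[OF i] by simp
  qed
  finally have "(\<integral>x. h x * S x \<partial>R) = limit_energy" using int(2)[OF bS] by simp
  \<comment> \<open>The part of the entropy integrand left once the pointwise nonnegative part
    \<open>e\<close> is split off. Its first bracket integrates to zero because both densities have
    mass 1, and \<open>h x * S x\<close> integrates to a constant because it sees \<gamma> only
    through its marginals.\<close>
  define r where "r x = (h x - limit_density x) + h x * S x" for x
  note il = integrable_R[OF bounded_measurable_limit_density]
  have ir: "integrable R r" unfolding r_def using ih(1) il int(1)[OF bS] by auto
  have "(\<integral>x. r x \<partial>R) = (\<integral>x. h x - limit_density x \<partial>R) + (\<integral>x. h x * S x \<partial>R)"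
    unfolding r_def using ih(1) il int(1)[OF bS] by (intro Bochner_Integration.integral_add) auto
  also have "(\<integral>x. h x - limit_density x \<partial>R) = (\<integral>x. h x \<partial>R) - (\<integral>x. limit_density x \<partial>R)"
    using ih(1) il by (intro Bochner_Integration.integral_diff) auto
  finally have rI: "(\<integral>x. r x \<partial>R) = limit_energy"
    unfolding ih(2) integral_limit_density using \<open>(\<integral>x. h x * S x \<partial>R) = limit_energy\<close> by simp
  define e where "e x = h x * ln (h x / limit_density x) - h x + limit_density x" for x
  have em: "e \<in> borel_measurable R" unfolding e_def by measurable
  have e0: "e x \<ge> 0" if "x \<in> space R" for x
    unfolding e_def by (rule relative_entropy_density_nonneg[OF h0 limit_density_pos[OF that]])
  \<comment> \<open>Where \<open>h\<close> vanishes, the left side is 0 and the two copies of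
    \<open>limit_density x\<close> in \<open>e\<close> and \<open>r\<close> cancel.\<close>
  have "h x * ln (h x / gibbs c \<epsilon> x) = e x + r x" if x: "x \<in> space R" for x
  proof (cases "h x = 0")
    case False
    hence hp: "h x > 0" using h0[of x] by simp
    have l: "limit_density x = exp (S x) * gibbs c \<epsilon> x"
      unfolding limit_density_def S_def
      by (rule gibbs_density_exp[OF harnack_limit_potential x])
    have "ln (h x / limit_density x) = ln (h x / gibbs c \<epsilon> x) - S x"
      unfolding l using hp kernel_pos[of x] by (simp add: ln_div ln_mult)
    thus ?thesis unfolding e_def r_def by (simp only:) (simp add: algebra_simps)
  qed (simp add: e_def r_def)
  hence "ereal_integral R (\<lambda>x. h x * ln (h x / gibbs c \<epsilon> x)) = ereal_integral R (\<lambda>x. e x + r x)"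
    by (intro ereal_integral_cong_AE AE_I2)
  also have "\<dots> = enn2ereal (\<integral>\<^sup>+x. ennreal (e x) \<partial>R) + ereal (\<integral>x. r x \<partial>R)"
    by (rule ereal_integral_add_nonneg[OF em e0 ir])
  finally show ?thesis using ac unfolding KL_def rI e_def h_def by (simp only: if_True)
qed

lemma real_density_limit_coupling: "AE x in R. real_density R limit_coupling x = limit_density x"
  unfolding limit_coupling_def
  by (intro prob_space.real_density_density[OF prob_space_R] bounded_measurable_measurable
      bounded_measurable_limit_density less_imp_le limit_density_pos)

lemma KL_limit_coupling: "KL R (gibbs c \<epsilon>) limit_coupling = ereal limit_energy"
proof -
  have "absolutely_continuous R limit_coupling"
    unfolding limit_coupling_def
    by (intro absolutely_continuousI_density measurable_compose[OF _ measurable_ennreal]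
        bounded_measurable_measurable bounded_measurable_limit_density)
  from KL_coupling[OF limit_coupling_in_couplings this]
  have KL: "KL R (gibbs c \<epsilon>) limit_coupling = enn2ereal (\<integral>\<^sup>+x. ennreal (real_density R limit_coupling x *
      ln (real_density R limit_coupling x / limit_density x)
      - real_density R limit_coupling x + limit_density x) \<partial>R) + ereal limit_energy" .
  have "AE x in R. ennreal (real_density R limit_coupling x *
      ln (real_density R limit_coupling x / limit_density x)
      - real_density R limit_coupling x + limit_density x) = 0"
    using real_density_limit_coupling by eventually_elim simp
  from nn_integral_cong_AE[OF this] show ?thesis unfolding KL by (simp add: zero_ennreal.rep_eq)
qed

text \<open>By the splitting of the entropy, the excess over \<open>limit_energy\<close> is the
  integral of a nonnegative function, which vanishes almost everywhere only if the two densities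
  agree almost everywhere.\<close>

lemma KL_coupling_minimal:
  assumes \<gamma>: "\<gamma> \<in> couplings N M"
  shows "ereal limit_energy \<le> KL R (gibbs c \<epsilon>) \<gamma>"
    and "KL R (gibbs c \<epsilon>) \<gamma> \<le> ereal limit_energy \<Longrightarrow> \<gamma> = limit_coupling"
proof -
  have G: "prob_space \<gamma>" "sets \<gamma> = sets R" using \<gamma> by (auto simp: couplings_def)
  let ?h = "real_density R \<gamma>"
  let ?e = "\<lambda>x. ?h x * ln (?h x / limit_density x) - ?h x + limit_density x"
  have gm [measurable]: "limit_density \<in> borel_measurable R"
    by (rule bounded_measurable_measurable[OF bounded_measurable_limit_density])
  show "ereal limit_energy \<le> KL R (gibbs c \<epsilon>) \<gamma>"
  proof (cases "absolutely_continuous R \<gamma>")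
    case True
    have "0 + ereal limit_energy \<le> enn2ereal (\<integral>\<^sup>+x. ennreal (?e x) \<partial>R) + ereal limit_energy"
      by (intro add_mono) auto
    thus ?thesis unfolding KL_coupling[OF \<gamma> True] by simp
  qed (simp add: KL_def)
  assume le: "KL R (gibbs c \<epsilon>) \<gamma> \<le> ereal limit_energy"
  hence ac: "absolutely_continuous R \<gamma>" by (auto simp: KL_def split: if_splits)
  have "(\<integral>\<^sup>+x. ennreal (?e x) \<partial>R) = 0"
    using le unfolding KL_coupling[OF \<gamma> ac]
    by (cases "\<integral>\<^sup>+x. ennreal (?e x) \<partial>R") auto
  moreover have "(\<lambda>x. ennreal (?e x)) \<in> borel_measurable R" by measurable
  ultimately have "AE x in R. ennreal (?e x) = 0" using nn_integral_0_iff_AE by blast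
  hence "AE x in R. ?h x = limit_density x"
    using AE_space
  proof eventually_elim
    case (elim x)
    note * = relative_entropy_density_nonneg[OF real_density_nonneg limit_density_pos[OF elim(2)]]
    have "?e x = 0" using elim(1) *(1)[of R \<gamma> x] by (simp add: ennreal_eq_0_iff)
    thus ?case using *(2)[of R \<gamma> x] by blast
  qed
  hence "AE x in R. ennreal (?h x) = ennreal (limit_density x)" by eventually_elim simp
  hence "density R (\<lambda>x. ennreal (?h x)) = limit_coupling"
    unfolding limit_coupling_def
    by (intro density_cong measurable_compose[OF _ measurable_ennreal] real_density_measurable gm)
  thus "\<gamma> = limit_coupling" using density_real_density[OF prob_space_R G(1) ac G(2)] by simp
qed

lemma solves_schrodinger_problem_iff:
  assumes "\<epsilon> > 0"
  shows "solves_schrodinger_problem N M c \<epsilon> \<gamma> \<longleftrightarrow> \<gamma> = limit_coupling"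
proof
  assume "solves_schrodinger_problem N M c \<epsilon> \<gamma>"
  hence \<gamma>: "\<gamma> \<in> couplings N M"
    and min: "\<not> ereal \<epsilon> * KL R (gibbs c \<epsilon>) limit_coupling < ereal \<epsilon> * KL R (gibbs c \<epsilon>) \<gamma>"
    using limit_coupling_in_couplings by (auto simp: solves_schrodinger_problem_def is_arg_min_def)
  have "KL R (gibbs c \<epsilon>) \<gamma> \<le> ereal limit_energy"
  proof (rule ccontr)
    assume "\<not> ?thesis"
    hence "KL R (gibbs c \<epsilon>) limit_coupling < KL R (gibbs c \<epsilon>) \<gamma>" by (simp only: KL_limit_coupling not_le)
    hence "ereal \<epsilon> * KL R (gibbs c \<epsilon>) limit_coupling < ereal \<epsilon> * KL R (gibbs c \<epsilon>) \<gamma>"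
      using assms by (intro ereal_mult_strict_left_mono) auto
    with min show False by simp
  qed
  thus "\<gamma> = limit_coupling" by (rule KL_coupling_minimal(2)[OF \<gamma>])
next
  assume "\<gamma> = limit_coupling"
  moreover have "ereal \<epsilon> * KL R (gibbs c \<epsilon>) limit_coupling \<le> ereal \<epsilon> * KL R (gibbs c \<epsilon>) \<gamma>'"
    if "\<gamma>' \<in> couplings N M" for \<gamma>'
    unfolding KL_limit_coupling
    by (intro ereal_mult_left_mono KL_coupling_minimal(1)[OF that]) (use assms in simp)
  ultimately show "solves_schrodinger_problem N M c \<epsilon> \<gamma>"
    using limit_coupling_in_couplings
    by (auto simp: solves_schrodinger_problem_def is_arg_min_def not_less)
qed

lemma densities_Lp_tendsto:
  assumes p: "p \<ge> 1"
  shows "Lp_tendsto p R (\<lambda>n x. (\<Prod>i\<in>{1..N}. potential n i (x i)) * gibbs c \<epsilon> x)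
    (real_density R limit_coupling)"
proof -
  \<comment> \<open>No entry of index at least 1 has been updated in stage \<open>W n 0\<close>, so
    this is the density built from the potentials of index \<open>n\<close> alone.\<close>
  have e: "(\<lambda>x. (\<Prod>i\<in>{1..N}. potential n i (x i)) * gibbs c \<epsilon> x) = W n 0" for n
    unfolding gibbs_density_def by (auto simp: sweep_def intro!: ext prod.cong)
  have "Lp_tendsto p R (\<lambda>n. W n 0) (real_density R limit_coupling)"
  proof (rule prob_space.Lp_tendsto_bounded[OF prob_space_R _ _ _ _ p])
    show "W n 0 \<in> borel_measurable R" for n
      by (rule bounded_measurable_measurable[OF bounded_measurable_W])
    show "real_density R limit_coupling \<in> borel_measurable R" by simp
    show "AE x in R. \<bar>W n 0 x\<bar> \<le> B" for n
    proof (rule AE_I2)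
      fix x assume x: "x \<in> space R"
      show "\<bar>W n 0 x\<bar> \<le> B" using W_bounds(1)[OF _ x, of 0 n] W_pos[OF x, of n 0] by simp
    qed
    show "AE x in R. (\<lambda>n. W n 0 x) \<longlonglongrightarrow> real_density R limit_coupling x"
      using real_density_limit_coupling AE_space
    proof eventually_elim
      case (elim x)
      show ?case unfolding elim(1) limit_density_def by (rule W_tendsto[OF elim(2)])
    qed
  qed
  thus ?thesis unfolding e .
qed

end

section \<open>Transfer to the given marginals\<close>

lemma ipfp_cong:
  assumes "\<And>i. i \<in> {1..N} \<Longrightarrow> \<rho> i = \<rho>' i"
  shows "ipfp N \<rho> c \<epsilon> n j = ipfp N \<rho>' c \<epsilon> n j"
proof (induction n arbitrary: j)
  case 0
  show ?case by (simp only: ipfp.simps(1))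
next
  case (Suc n)
  show ?case
  \<comment> \<open>The induction runs over every \<open>j\<close>, also beyond \<open>N\<close>, so
    that the two iterations agree as functions of all their indices.\<close>
  proof (induction j rule: less_induct)
    case (less j)
    have P: "(\<Pi>\<^sub>M i\<in>{1..N} - {j}. \<rho> i) = (\<Pi>\<^sub>M i\<in>{1..N} - {j}. \<rho>' i)"
      by (rule PiM_cong) (use assms in auto)
    have Q: "(\<Prod>i\<in>{1..<j}. ipfp N \<rho> c \<epsilon> (Suc n) i (y i)) = (\<Prod>i\<in>{1..<j}. ipfp N \<rho>' c \<epsilon> (Suc n) i (y i))" for y
      by (intro prod.cong refl fun_cong[OF less.IH]) simp
    have S: "(\<Prod>i\<in>{j<..N}. ipfp N \<rho> c \<epsilon> n i (y i)) = (\<Prod>i\<in>{j<..N}. ipfp N \<rho>' c \<epsilon> n i (y i))" for y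
      by (intro prod.cong refl fun_cong[OF Suc.IH])
    show ?case by (subst (1 2) ipfp.simps(2)) (simp only: P Q S)
  qed
qed

theorem theorem1p4:
  fixes N :: nat and X :: "nat \<Rightarrow> 'a metric" and \<rho> :: "nat \<Rightarrow> 'a measure"
    and c :: "(nat \<Rightarrow> 'a) \<Rightarrow> real" and \<epsilon> :: real
  assumes "N \<ge> 2"
    and "\<And>i. i \<in> {1..N} \<Longrightarrow> polish_metric (X i)"
    and "\<And>i. i \<in> {1..N} \<Longrightarrow> prob_space (\<rho> i)"
    and "\<And>i. i \<in> {1..N} \<Longrightarrow> sets (\<rho> i) = sets (borel_of (mtopology_of (X i)))"
    and "c \<in> borel_measurable (borel_of (product_topology (\<lambda>i. mtopology_of (X i)) {1..N}))"
    and "bounded (c ` (\<Pi>\<^sub>E i\<in>{1..N}. mspace (X i)))"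
    and "\<epsilon> > 0"
  shows "(\<exists>(l :: nat \<Rightarrow> nat \<Rightarrow> real) (a :: nat \<Rightarrow> 'a \<Rightarrow> real).
            (\<forall>n. \<forall>i\<in>{1..N}. l n i > 0) \<and> (\<forall>n. (\<Prod>i\<in>{1..N}. l n i) = 1) \<and>
            schrodinger_system N \<rho> c \<epsilon> a \<and>
            (\<forall>i\<in>{1..N}. \<forall>p\<ge>1. Lp_tendsto p (\<rho> i) (\<lambda>n x. ipfp N \<rho> c \<epsilon> n i x / l n i) (a i)))
       \<and> (\<exists>!\<gamma>. solves_schrodinger_problem N \<rho> c \<epsilon> \<gamma>)
       \<and> (\<forall>\<gamma>. solves_schrodinger_problem N \<rho> c \<epsilon> \<gamma> \<longrightarrow>
            (\<forall>p\<ge>1. Lp_tendsto p (\<Pi>\<^sub>M i\<in>{1..N}. \<rho> i)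
               (\<lambda>n x. (\<Prod>i\<in>{1..N}. ipfp N \<rho> c \<epsilon> n i (x i)) * gibbs c \<epsilon> x)
               (real_density (\<Pi>\<^sub>M i\<in>{1..N}. \<rho> i) \<gamma>)))"
proof -
  \<comment> \<open>The product locale asks for a probability measure at every index, so the family
    is continued outside \<open>{1..N}\<close> by one of its members.\<close>
  define M where "M i = (if i \<in> {1..N} then \<rho> i else \<rho> 1)" for i
  have M: "M i = \<rho> i" if "i \<in> {1..N}" for i using that by (simp only: M_def if_True)
  have prob: "prob_space (M i)" for i using assms(1,3) by (auto simp: M_def)
  have R: "Pi\<^sub>M J M = Pi\<^sub>M J \<rho>" if "J \<subseteq> {1..N}" for J
    by (rule PiM_cong) (use M that in blast)+
  have sets_R: "sets (Pi\<^sub>M {1..N} M) = sets (borel_of (product_topology (\<lambda>i. mtopology_of (X i)) {1..N}))"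
  proof -
    have "sets (Pi\<^sub>M {1..N} M) = sets (\<Pi>\<^sub>M i\<in>{1..N}. borel_of (mtopology_of (X i)))"
      by (rule sets_PiM_cong[OF refl]) (simp only: M assms(4))
    also have "\<dots> = sets (borel_of (product_topology (\<lambda>i. mtopology_of (X i)) {1..N}))"
      by (rule sets_borel_of_product[symmetric]) (use assms(2) in \<open>auto simp: polish_metric_def\<close>)
    finally show ?thesis .
  qed
  have space_M: "space (M i) = mspace (X i)" if "i \<in> {1..N}" for i
    using sets_eq_imp_space_eq[OF assms(4)[OF that]] M[OF that] by simp
  have space_R: "space (Pi\<^sub>M {1..N} M) = (\<Pi>\<^sub>E i\<in>{1..N}. mspace (X i))"
    unfolding space_PiM by (rule PiE_cong) (rule space_M)
  have cm: "c \<in> borel_measurable (Pi\<^sub>M {1..N} M)"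
    using assms(5) measurable_cong_sets[OF sets_R refl] by blast
  obtain b where b: "\<And>x. x \<in> space (Pi\<^sub>M {1..N} M) \<Longrightarrow> \<bar>c x\<bar> \<le> b"
    using assms(6) unfolding bounded_iff space_R by auto
  \<comment> \<open>The absolute value makes \<open>K \<ge> 1\<close> hold whatever the sign of
    \<open>b\<close>.\<close>
  define K where "K = exp (\<bar>b\<bar> / \<epsilon>)"
  have kb: "1 / K \<le> gibbs c \<epsilon> x \<and> gibbs c \<epsilon> x \<le> K" if x: "x \<in> space (Pi\<^sub>M {1..N} M)" for x
  proof -
    have "\<bar>c x\<bar> \<le> \<bar>b\<bar>" using b[OF x] by linarith
    hence "- c x \<le> \<bar>b\<bar>" "- \<bar>b\<bar> \<le> - c x" by linarith+
    hence "- c x / \<epsilon> \<le> \<bar>b\<bar> / \<epsilon>" "- \<bar>b\<bar> / \<epsilon> \<le> - c x / \<epsilon>"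
      using assms(7) by (intro divide_right_mono; simp)+
    thus ?thesis unfolding K_def gibbs_def by (simp add: exp_minus[symmetric] inverse_eq_divide[symmetric])
  qed
  have km: "gibbs c \<epsilon> \<in> borel_measurable (Pi\<^sub>M {1..N} M)"
    unfolding gibbs_def using cm by measurable
  interpret product_prob_space M "{1..N}" by (rule product_prob_spaceI[OF prob])
  interpret gibbs_kernel N M c \<epsilon> K
    by unfold_locales (use km kb assms(1,7) in \<open>simp_all add: K_def\<close>)
  have ipfp: "ipfp N \<rho> c \<epsilon> = ipfp N M c \<epsilon>"
    by (intro ext fun_cong[OF ipfp_cong]) (simp only: M)
  have couplings: "couplings N \<rho> = couplings N M"
    unfolding couplings_def using M R[OF order_refl] by auto
  have solves: "solves_schrodinger_problem N \<rho> c \<epsilon> \<gamma> \<longleftrightarrow> \<gamma> = limit_coupling" for \<gamma>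
    unfolding solves_schrodinger_problem_iff[OF assms(7), symmetric]
    by (simp only: solves_schrodinger_problem_def couplings R[OF order_refl])
  have "schrodinger_system N \<rho> c \<epsilon> limit_potential"
    using limit_solves_system by (simp only: schrodinger_system_def R[OF Diff_subset] M ball_triv simp_thms cong: ball_cong)
  moreover have "Lp_tendsto p (\<rho> i) (\<lambda>n x. ipfp N \<rho> c \<epsilon> n i x / 1) (limit_potential i)"
    if "i \<in> {1..N}" "p \<ge> 1" for i p
    using potential_Lp_tendsto[OF that] unfolding M[OF that(1)] ipfp by simp
  ultimately have "\<exists>(l :: nat \<Rightarrow> nat \<Rightarrow> real) (a :: nat \<Rightarrow> 'a \<Rightarrow> real).
            (\<forall>n. \<forall>i\<in>{1..N}. l n i > 0) \<and> (\<forall>n. (\<Prod>i\<in>{1..N}. l n i) = 1) \<and>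
            schrodinger_system N \<rho> c \<epsilon> a \<and>
            (\<forall>i\<in>{1..N}. \<forall>p\<ge>1. Lp_tendsto p (\<rho> i) (\<lambda>n x. ipfp N \<rho> c \<epsilon> n i x / l n i) (a i))"
    \<comment> \<open>The potentials converge as they are, so all the constants \<open>l n i\<close>
      are taken to be 1.\<close>
    by (intro exI[of _ "\<lambda>_ _. 1"] exI[of _ limit_potential]) simp
  moreover have "Lp_tendsto p (\<Pi>\<^sub>M i\<in>{1..N}. \<rho> i)
               (\<lambda>n x. (\<Prod>i\<in>{1..N}. ipfp N \<rho> c \<epsilon> n i (x i)) * gibbs c \<epsilon> x)
               (real_density (\<Pi>\<^sub>M i\<in>{1..N}. \<rho> i) limit_coupling)" if "p \<ge> 1" for p
    using densities_Lp_tendsto[OF that] unfolding ipfp R[OF order_refl] .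
  ultimately show ?thesis unfolding solves by blast
qed

end
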